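(* Let $i\in\{1,2,3\}$ and $(\delta,\sigma;u,v)\in(\mathbb Z/2\mathbb Z)^3\times\mathbb C^3$ ($\delta\in(\mathbb Z/2\mathbb Z)^2$, $\sigma\in\mathbb Z/2\mathbb Z$, $u\in\mathbb C^2$, $v\in\mathbb C$). Every $\mathbb D\in\mathrm{Diff}_{G'_{SL,i}}(I(\delta,u)_{SL},J(\sigma,v)_{SL})$, viewed as an operator $C^\infty(\mathbb R^3)\to C^\infty(\mathbb R)$, is a finite linear combination of operators each of which belongs to $\mathrm{Diff}_{G_i'}(I(\xi,\lambda),J(\eta,\nu))$ for some $(\xi,\eta;\lambda,\nu)\in(\mathbb Z/2\mathbb Z)^5\times\mathbb C^5$ (the parameters may vary from one operator to another).
   Context: $GL$-case. $G=GL(3,\mathbb R)$, $G'=GL(2,\mathbb R)$; $P=MAN_+\subset G$ is the group of invertible upper triangular matrices, $M=\{\mathrm{diag}(\pm1,\pm1,\pm1)\}$, $A$ = positive diagonal matrices, $N_+$ = upper unipotent. For $\xi\in(\mathbb Z/2\mathbb Z)^3,\lambda\in\mathbb C^3$, $I(\xi,\lambda)$ is the unnormalized principal series: smooth $f$ on $G$ with $f(gman)=\prod_jm_j^{-\xi_j}\prod_ja_j^{-\lambda_j}f(g)$, with left translation; $J(\eta,\nu)$ ($\eta\in(\mathbb Z/2\mathbb Z)^2,\nu\in\mathbb C^2$) is the analogous principal series of $G'$ induced from its upper triangular subgroup $P'$. Embeddings: $\iota_1(g')=\begin{pmatrix}g'&0\\0&1\end{pmatrix}$, $\iota_2(g')=\begin{pmatrix}1&0\\0&g'\end{pmatrix}$,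 $\iota_3\begin{pmatrix}a&b\\c&d\end{pmatrix}=\begin{pmatrix}a&0&b\\0&1&0\\c&0&d\end{pmatrix}$; $G_i'=\iota_i(G')$. $\mathrm{Diff}_{G_i'}(I(\xi,\lambda),J(\eta,\nu))$ is the space of $G_i'$-intertwining differential operators with respect to $G_i'/\iota_i(P')\to G/P$. $SL$-case. $G_{SL}=SL(3,\mathbb R)$, $G'_{SL}=SL(2,\mathbb R)$, $G'_{SL,i}=\iota_i(SL(2,\mathbb R))$. $I(\delta,u)_{SL}$ is the unnormalized principal series of $SL(3,\mathbb R)$ induced from the character of its upper triangular subgroup given by $\mathrm{diag}(m_1,m_2,m_3)\mapsto m_1^{\delta_1}m_3^{\delta_2}$ ($m_j=\pm1$, $m_1m_2m_3=1$), $\exp(t_1(E_{11}-E_{22})+t_2(E_{22}-E_{33}))\mapsto e^{u_1t_1+u_2t_2}$, trivial on $N_+$; $J(\sigma,v)_{SL}$ is the unnormalized principal series of $SL(2,\mathbb R)$ (regarded as a representation of $G'_{SL,i}$) induced from the character $\pm I\mapsto(\pm1)^\sigma$, $\exp(t(E_{11}-E_{22}))\mapsto e^{vt}$, trivial on the upper unipotent group. $\mathrm{Diff}_{G'_{SL,i}}(I(\delta,u)_{SL},J(\sigma,v)_{SL})$ is the space of $G'_{SL,i}$-intertwining differential operators between them (with respect to the natural map of flag varieties). Coordinates. With $N_1^-=E_{21},N_2^-=E_{32},N_3^-=E_{31}$, restrict functions to the lower unipotent group via $(x_1,x_2,x_3)\mapsto\exp(x_1N_1^-+x_2N_2^-+x_3N_3^-)$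 and to its intersection with $G_i'$ via $x_i\mapsto\exp(x_iN_i^-)$; thereby all the operators above, in both the $GL$- and $SL$-cases, are viewed as operators $C^\infty(\mathbb R^3)\to C^\infty(\mathbb R)$. *)

theory Defs
  imports "HOL-Analysis.Analysis" "HOL-Library.Z2"
begin

text \<open>
  Matrices have type \<^typ>\<open>real^3^3\<close> and \<^typ>\<open>real^2^2\<close>, with rows and columns numbered
  1, 2, 3 and 1, 2. In the index type \<^typ>\<open>3\<close> the numeral 3 denotes 0, so the order of
  that type is not the order 1, 2, 3 of rows and columns; triangularity is therefore spelled out
  entrywise. Elements of Z/2Z have type \<^typ>\<open>bit\<close>.
\<close>

section \<open>Smooth functions\<close>

primrec iter_deriv ::
  "'a::real_normed_vector list \<Rightarrow> ('a \<Rightarrow> complex) \<Rightarrow> 'a \<Rightarrow> complex"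
where
  "iter_deriv [] f = f"
| "iter_deriv (v # vs) f = (\<lambda>x. frechet_derivative (iter_deriv vs f) (at x) v)"

text \<open>For open \<open>U\<close> this is the class of infinitely differentiable functions on \<open>U\<close>:
  all iterated directional derivatives exist and are (totally) differentiable, hence continuous.\<close>

definition smooth_open :: "'a::real_normed_vector set \<Rightarrow> ('a \<Rightarrow> complex) \<Rightarrow> bool" where
  "smooth_open U f \<longleftrightarrow> (\<forall>vs. \<forall>x\<in>U. iter_deriv vs f differentiable (at x))"

text \<open>Smoothness on an embedded submanifold (in particular on the hypersurface of matrices of
  determinant one): local existence of smooth extensions to the ambient space.\<close>

definition smooth_on :: "'a::real_normed_vector set \<Rightarrow> ('a \<Rightarrow> complex) \<Rightarrow> bool" where
  "smooth_on S f \<longleftrightarrow>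
     (\<forall>x\<in>S. \<exists>U h. open U \<and> x \<in> U \<and> smooth_open U h \<and> (\<forall>y\<in>U \<inter> S. h y = f y))"

definition partial :: "nat^3 \<Rightarrow> (real^3 \<Rightarrow> complex) \<Rightarrow> real^3 \<Rightarrow> complex" where
  "partial \<alpha> = iter_deriv
     (replicate (\<alpha>$1) (axis 1 1) @ replicate (\<alpha>$2) (axis 2 1) @ replicate (\<alpha>$3) (axis 3 1))"


section \<open>Groups and characters\<close>

definition GL :: "(real^'n^'n) set" where
  "GL = {g. det g \<noteq> 0}"

definition SL :: "(real^'n^'n) set" where
  "SL = {g. det g = 1}"

definition upper3 :: "(real^3^3) set" where
  "upper3 = {p. p$2$1 = 0 \<and> p$3$1 = 0 \<and> p$3$2 = 0}"

definition upper2 :: "(real^2^2) set" where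
  "upper2 = {p. p$2$1 = 0}"

definition sign_pow :: "real \<Rightarrow> bit \<Rightarrow> complex" where
  "sign_pow m \<epsilon> = (if \<epsilon> = 0 then 1 else of_real m)"

text \<open>If \<open>p = m a n\<close> is the decomposition of an invertible upper triangular matrix along
  \<open>P = M A N\<close>, then \<open>m\<^sub>j = sgn p\<^sub>j\<^sub>j\<close> and \<open>a\<^sub>j = \<bar>p\<^sub>j\<^sub>j\<bar>\<close>. This turns the characters of the minimal
  parabolic subgroups, given on \<open>M\<close> and \<open>A\<close> and trivial on \<open>N\<close>, into functions of \<open>p\<close>.\<close>

definition char_GL :: "bit^'n \<Rightarrow> complex^'n \<Rightarrow> real^'n^'n \<Rightarrow> complex" where
  "char_GL \<xi> l p =
     (\<Prod>j\<in>UNIV. sign_pow (sgn (p$j$j)) (\<xi>$j)) * (\<Prod>j\<in>UNIV. of_real \<bar>p$j$j\<bar> powr (l$j))"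

text \<open>\<open>exp (t\<^sub>1 (E\<^sub>1\<^sub>1 - E\<^sub>2\<^sub>2) + t\<^sub>2 (E\<^sub>2\<^sub>2 - E\<^sub>3\<^sub>3))\<close> has diagonal
  \<open>e\<^bsup>t1\<^esup>, e\<^bsup>t2 - t1\<^esup>, e\<^bsup>- t2\<^esup>\<close>, so \<open>t\<^sub>1 = ln a\<^sub>1\<close> and \<open>t\<^sub>2 = - ln a\<^sub>3\<close>.\<close>

definition char_SL3 :: "bit^2 \<Rightarrow> complex^2 \<Rightarrow> real^3^3 \<Rightarrow> complex" where
  "char_SL3 \<delta> u p =
     sign_pow (sgn (p$1$1)) (\<delta>$1) * sign_pow (sgn (p$3$3)) (\<delta>$2) *
     exp (u$1 * of_real (ln \<bar>p$1$1\<bar>) + u$2 * of_real (- ln \<bar>p$3$3\<bar>))"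

definition char_SL2 :: "bit \<Rightarrow> complex \<Rightarrow> real^2^2 \<Rightarrow> complex" where
  "char_SL2 \<sigma> v p = sign_pow (sgn (p$1$1)) \<sigma> * exp (v * of_real (ln \<bar>p$1$1\<bar>))"


section \<open>Unnormalized principal series\<close>

text \<open>Functions on a group of matrices are extended by zero to all matrices, so that distinct
  elements of the set below are distinct functions on the group.\<close>

definition induced ::
  "(real^'n^'n) set \<Rightarrow> (real^'n^'n) set \<Rightarrow> (real^'n^'n \<Rightarrow> complex) \<Rightarrow> (real^'n^'n \<Rightarrow> complex) set"
where
  "induced G P \<psi> = {f. smooth_on G f \<and> (\<forall>g. g \<notin> G \<longrightarrow> f g = 0) \<and>
     (\<forall>g\<in>G. \<forall>p\<in>P. f (g ** p) = inverse (\<psi> p) * f g)}"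

definition left_translate ::
  "real^'n^'n \<Rightarrow> (real^'n^'n \<Rightarrow> complex) \<Rightarrow> real^'n^'n \<Rightarrow> complex"
where
  "left_translate h f = (\<lambda>g. f (matrix_inv h ** g))"

definition I_GL :: "bit^3 \<Rightarrow> complex^3 \<Rightarrow> (real^3^3 \<Rightarrow> complex) set" where
  "I_GL \<xi> l = induced GL (GL \<inter> upper3) (char_GL \<xi> l)"

definition J_GL :: "bit^2 \<Rightarrow> complex^2 \<Rightarrow> (real^2^2 \<Rightarrow> complex) set" where
  "J_GL \<eta> \<nu> = induced GL (GL \<inter> upper2) (char_GL \<eta> \<nu>)"

definition I_SL :: "bit^2 \<Rightarrow> complex^2 \<Rightarrow> (real^3^3 \<Rightarrow> complex) set" where
  "I_SL \<delta> u = induced SL (SL \<inter> upper3) (char_SL3 \<delta> u)"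

definition J_SL :: "bit \<Rightarrow> complex \<Rightarrow> (real^2^2 \<Rightarrow> complex) set" where
  "J_SL \<sigma> v = induced SL (SL \<inter> upper2) (char_SL2 \<sigma> v)"


section \<open>Embeddings and coordinates\<close>

definition emb :: "3 \<Rightarrow> real^2^2 \<Rightarrow> real^3^3" where
  "emb i g =
     (if i = 1 then
        vector [vector [g$1$1, g$1$2, 0], vector [g$2$1, g$2$2, 0], vector [0, 0, 1]]
      else if i = 2 then
        vector [vector [1, 0, 0], vector [0, g$1$1, g$1$2], vector [0, g$2$1, g$2$2]]
      else
        vector [vector [g$1$1, 0, g$1$2], vector [0, 1, 0], vector [g$2$1, 0, g$2$2]])"

text \<open>\<open>lower3 x = exp X\<close> for \<open>X = x\<^sub>1 E\<^sub>2\<^sub>1 + x\<^sub>2 E\<^sub>3\<^sub>2 + x\<^sub>3 E\<^sub>3\<^sub>1\<close>; here \<open>X\<^sup>2 = x\<^sub>1 x\<^sub>2 E\<^sub>3\<^sub>1\<close> and \<open>X\<^sup>3 = 0\<close>.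
  Similarly \<open>lower2 x = exp (x E\<^sub>2\<^sub>1)\<close>, and \<open>emb i (lower2 x) = lower3 (axis i x)\<close>
  is \<open>exp (x N\<^sub>i)\<close>.\<close>

definition lower3 :: "real^3 \<Rightarrow> real^3^3" where
  "lower3 x = vector [vector [1, 0, 0], vector [x$1, 1, 0], vector [x$3 + x$1 * x$2 / 2, x$2, 1]]"

definition lower2 :: "real \<Rightarrow> real^2^2" where
  "lower2 x = vector [vector [1, 0], vector [x, 1]]"


section \<open>Intertwining differential operators\<close>

text \<open>
  Differential operators \<open>D\<close> from sections over \<open>G/P\<close> to sections over \<open>G'/P'\<close> with respect to
  the map \<open>G'/P' \<longrightarrow> G/P\<close> induced by \<open>emb i\<close>: locally \<open>D\<close> takes a finite number of partial
  derivatives, evaluates them along the map, and combines them with smooth coefficients.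
  Around the point \<open>g P'\<close> we use the chart \<open>x \<mapsto> g (lower2 x) P'\<close> of \<open>G'/P'\<close> and the chart
  \<open>y \<mapsto> (emb i g) (lower3 y) P\<close> of \<open>G/P\<close>, and trivialize the line bundles by restricting
  equivariant functions on the groups to \<open>g (lower2 x)\<close> and \<open>(emb i g) (lower3 y)\<close>. In these
  charts the map is \<open>x \<mapsto> axis i x\<close>. Linearity of \<open>D\<close> on \<open>V\<close> is a consequence.
\<close>

definition diff_op ::
  "3 \<Rightarrow> (real^2^2) set \<Rightarrow> (real^3^3 \<Rightarrow> complex) set \<Rightarrow>
    ((real^3^3 \<Rightarrow> complex) \<Rightarrow> (real^2^2 \<Rightarrow> complex)) \<Rightarrow> bool"
where
  "diff_op i G' V D \<longleftrightarrow>
     (\<forall>g\<in>G'. \<exists>U S a. open U \<and> 0 \<in> U \<and> finite S \<and> (\<forall>\<alpha>\<in>S. smooth_on U (a \<alpha>)) \<and>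
        (\<forall>f\<in>V. \<forall>x\<in>U. D f (g ** lower2 x) =
           (\<Sum>\<alpha>\<in>S. a \<alpha> x * partial \<alpha> (\<lambda>y. f (emb i g ** lower3 y)) (axis i x))))"

definition intertwining_diff_ops ::
  "3 \<Rightarrow> (real^2^2) set \<Rightarrow> (real^3^3 \<Rightarrow> complex) set \<Rightarrow> (real^2^2 \<Rightarrow> complex) set \<Rightarrow>
    ((real^3^3 \<Rightarrow> complex) \<Rightarrow> (real^2^2 \<Rightarrow> complex)) set"
where
  "intertwining_diff_ops i G' V W = {D. (\<forall>f\<in>V. D f \<in> W) \<and> diff_op i G' V D \<and>
     (\<forall>h\<in>G'. \<forall>f\<in>V. D (left_translate (emb i h) f) = left_translate h (D f))}"

text \<open>The operator from smooth functions on \<open>\<real>\<^sup>3\<close> to smooth functions on \<open>\<real>\<close> given by a local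
  operator \<open>D\<close> on \<open>V\<close>. A smooth \<open>F\<close> need not be globally of the form \<open>f \<circ> lower3\<close> with \<open>f \<in> V\<close>,
  but it is near every point, and \<open>D f\<close> at a point depends only on \<open>f\<close> near its image.
  Functions that are not smooth are sent to zero.\<close>

definition coord_op ::
  "3 \<Rightarrow> (real^3^3 \<Rightarrow> complex) set \<Rightarrow> ((real^3^3 \<Rightarrow> complex) \<Rightarrow> (real^2^2 \<Rightarrow> complex)) \<Rightarrow>
    (real^3 \<Rightarrow> complex) \<Rightarrow> real \<Rightarrow> complex"
where
  "coord_op i V D F x =
     (if smooth_on UNIV F then
        (THE c. \<exists>f\<in>V. (\<forall>\<^sub>F y in nhds (axis i x). f (lower3 y) = F y) \<and> c = D f (lower2 x))
      else 0)"

definition Diff_GL ::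
  "3 \<Rightarrow> bit^3 \<Rightarrow> complex^3 \<Rightarrow> bit^2 \<Rightarrow> complex^2 \<Rightarrow> ((real^3 \<Rightarrow> complex) \<Rightarrow> real \<Rightarrow> complex) set"
where
  "Diff_GL i \<xi> l \<eta> \<nu> =
     coord_op i (I_GL \<xi> l) ` intertwining_diff_ops i GL (I_GL \<xi> l) (J_GL \<eta> \<nu>)"

definition Diff_SL ::
  "3 \<Rightarrow> bit^2 \<Rightarrow> complex^2 \<Rightarrow> bit \<Rightarrow> complex \<Rightarrow> ((real^3 \<Rightarrow> complex) \<Rightarrow> real \<Rightarrow> complex) set"
where
  "Diff_SL i \<delta> u \<sigma> v =
     coord_op i (I_SL \<delta> u) ` intertwining_diff_ops i SL (I_SL \<delta> u) (J_SL \<sigma> v)"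

end

theory Submission
  imports Defs "HOL-Computational_Algebra.Polynomial"
begin

text \<open>
  An operator \<open>D\<close> intertwining representations of \<open>SL(2)\<close> is determined by the functional
  \<open>f \<mapsto> D f 1\<close>, because \<open>D f h\<close> is its value at the translate \<open>f (emb i h \<cdot>)\<close>. As \<open>D\<close> is a
  differential operator, the functional is a finite combination of partial derivatives of
  \<open>f \<circ> lower3\<close> at 0, called a jet below, and it is invariant under the upper unipotent subgroup
  of \<open>SL(2)\<close>. Conversely a jet \<open>L\<close> gives the operator \<open>f \<mapsto> (g \<mapsto> L (f (emb i g \<cdot>)))\<close> on functions
  on \<open>GL(3)\<close>, which intertwines the action of \<open>GL(2)\<close>. Its values lie in a principal series as soon
  as \<open>L\<close> is invariant under the upper unipotent subgroup and transforms by a character under the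
  diagonal matrices of \<open>GL(2)\<close>. So \<open>SL(2)\<close> and \<open>GL(2)\<close> differ only in the torus.

  The diagonal matrices of \<open>GL(3)\<close> rescale the three coordinates of \<open>lower3\<close>, hence they multiply
  every partial derivative at 0 by a character, and this character depends on the multi-index only
  through its \<open>weight\<close>. Sorting the monomials of \<open>L\<close> by weight splits \<open>L\<close> into finitely many jets
  that are torus equivariant. The splitting keeps unipotent invariance, since the torus normalizes
  the unipotent group: each part is a combination of the functionals \<open>f \<mapsto> L (f (t \<cdot>))\<close> for finitely
  many diagonal \<open>t\<close> (\<open>jet_weight_projection\<close>), and these functionals are all invariant
  (\<open>N_invariant_weight\<close>). The same combination shows that the operator of each part is again a
  differential operator near the identity (\<open>jet_local_weight\<close>). The operators of the parts are the
  required summands (\<open>jet_op_intertwining\<close>).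

  A function in the principal series of \<open>GL(3)\<close> with parameters \<open>(\<delta>\<^sub>1, 0, \<delta>\<^sub>2)\<close> and
  \<open>(u\<^sub>1, 0, - u\<^sub>2)\<close> restricts to a function in the one of \<open>SL(3)\<close> with parameters \<open>\<delta>, u\<close>, and
  \<open>lower3\<close> takes values in \<open>SL(3)\<close>; this is how \<open>D\<close> is applied to functions on \<open>GL(3)\<close>. To compare
  the operators in coordinates, every smooth germ on \<open>\<real>\<^sup>3\<close> has to come from the principal series
  of \<open>GL(3)\<close>; it is cut off by a bump function and transported to the big cell
  (\<open>I_GL_local_extension\<close>).
\<close>

section \<open>Calculus of smooth functions\<close>

definition dir_deriv :: "'a::real_normed_vector \<Rightarrow> ('a \<Rightarrow> complex) \<Rightarrow> 'a \<Rightarrow> complex" where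
  "dir_deriv v f = (\<lambda>x. frechet_derivative f (at x) v)"

text \<open>Inductions over lists of directions become inductions over the order \<open>k\<close>: sums, products and
  composites of smooth functions are treated by showing that their directional derivatives are
  built from functions of order \<open>k\<close> in the same way.\<close>

definition C_upto :: "nat \<Rightarrow> 'a::real_normed_vector set \<Rightarrow> ('a \<Rightarrow> complex) \<Rightarrow> bool" where
  "C_upto k U f \<longleftrightarrow> (\<forall>vs. length vs \<le> k \<longrightarrow> (\<forall>x\<in>U. iter_deriv vs f differentiable (at x)))"

lemma smooth_open_iff_C_upto: "smooth_open U f \<longleftrightarrow> (\<forall>k. C_upto k U f)"
  unfolding smooth_open_def C_upto_def by blast

lemma iter_deriv_append: "iter_deriv (vs @ ws) f = iter_deriv vs (iter_deriv ws f)"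
  by (induction vs) auto

lemma iter_deriv_snoc: "iter_deriv (vs @ [v]) f = iter_deriv vs (dir_deriv v f)"
  by (simp add: iter_deriv_append dir_deriv_def)

lemma C_upto_0: "C_upto 0 U f \<longleftrightarrow> (\<forall>x\<in>U. f differentiable (at x))"
  by (simp add: C_upto_def)

lemma C_upto_Suc:
  "C_upto (Suc k) U f \<longleftrightarrow> (\<forall>x\<in>U. f differentiable (at x)) \<and> (\<forall>v. C_upto k U (dir_deriv v f))"
proof (intro iffI conjI ballI allI)
  fix x assume "C_upto (Suc k) U f" "x \<in> U"
  then show "f differentiable (at x)"
    unfolding C_upto_def by (metis iter_deriv.simps(1) list.size(3) zero_le)
next
  fix v assume "C_upto (Suc k) U f"
  then show "C_upto k U (dir_deriv v f)"
    unfolding C_upto_def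
    by (metis (no_types, lifting) Suc_le_mono iter_deriv_snoc length_append_singleton)
next
  assume *: "(\<forall>x\<in>U. f differentiable (at x)) \<and> (\<forall>v. C_upto k U (dir_deriv v f))"
  show "C_upto (Suc k) U f"
    unfolding C_upto_def
  proof (intro allI impI ballI)
    fix vs :: "'a list" and x assume "length vs \<le> Suc k" "x \<in> U"
    then show "iter_deriv vs f differentiable (at x)"
      using * by (cases vs rule: rev_cases) (auto simp: iter_deriv_snoc C_upto_def)
  qed
qed

lemma C_upto_mono: "C_upto k U f \<Longrightarrow> j \<le> k \<Longrightarrow> V \<subseteq> U \<Longrightarrow> C_upto j V f"
  unfolding C_upto_def by (meson le_trans subsetD)

lemma C_upto_SucD: "C_upto (Suc k) U f \<Longrightarrow> C_upto k U f"
  using C_upto_mono by fastforce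

lemma C_upto_differentiable: "C_upto k U f \<Longrightarrow> x \<in> U \<Longrightarrow> f differentiable (at x)"
  using C_upto_mono[of k U f 0 U] by (simp add: C_upto_0)

lemma iter_deriv_cong:
  assumes "open U" "\<And>x. x \<in> U \<Longrightarrow> f x = g x" "x \<in> U"
  shows "iter_deriv vs f x = iter_deriv vs g x"
  using assms(3)
proof (induction vs arbitrary: x)
  case (Cons v vs)
  have "(iter_deriv vs f has_derivative D) (at x) \<longleftrightarrow> (iter_deriv vs g has_derivative D) (at x)" for D
    using Cons assms(1) has_derivative_transform_within_open[of _ D x UNIV U] by auto
  then show ?case by (simp add: frechet_derivative_def)
qed (use assms in auto)

lemma differentiable_cong_open:
  assumes "open U" "\<And>x. x \<in> U \<Longrightarrow> f x = g x" "x \<in> U" "f differentiable (at x)"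
  shows "g differentiable (at x)"
  using assms has_derivative_transform_within_open[of f _ x UNIV U g]
  unfolding differentiable_def by auto

lemma C_upto_cong:
  fixes U :: "'a::real_normed_vector set"
  assumes "open U" "\<And>x. x \<in> U \<Longrightarrow> f x = g x" "C_upto k U f"
  shows "C_upto k U g"
  unfolding C_upto_def
proof (intro allI impI ballI)
  fix vs :: "'a list" and x assume *: "length vs \<le> k" "x \<in> U"
  then have "iter_deriv vs f differentiable (at x)"
    using assms(3) by (simp add: C_upto_def)
  with assms(1) iter_deriv_cong[OF assms(1,2)] *(2) show "iter_deriv vs g differentiable (at x)"
    by (rule differentiable_cong_open)
qed

text \<open>The closure properties below rest on this rule, where \<open>D v\<close> is the expression that the rules of
  differentiation give for the derivative in direction \<open>v\<close>.\<close>

lemma C_upto_SucI: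
  assumes "open U"
    and "\<And>x. x \<in> U \<Longrightarrow> (f has_derivative (\<lambda>v. D v x)) (at x)"
    and "\<And>v. C_upto k U (D v)"
  shows "C_upto (Suc k) U f"
  unfolding C_upto_Suc
proof safe
  fix x assume "x \<in> U" then show "f differentiable (at x)"
    using assms(2) by (auto simp: differentiable_def)
next
  fix v show "C_upto k U (dir_deriv v f)"
    using assms(1) _ assms(3)[of v]
  proof (rule C_upto_cong)
    fix x assume "x \<in> U" then show "D v x = dir_deriv v f x"
      by (simp add: dir_deriv_def frechet_derivative_at[OF assms(2), symmetric])
  qed
qed

lemma C_upto_has_derivative:
  assumes "C_upto k U f" "x \<in> U"
  shows "(f has_derivative (\<lambda>v. dir_deriv v f x)) (at x)"
  using C_upto_differentiable[OF assms] frechet_derivative_works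
  unfolding dir_deriv_def by fastforce

lemma C_upto_const: "open U \<Longrightarrow> C_upto k U (\<lambda>x. c)"
proof (induction k arbitrary: c)
  case (Suc k)
  then show ?case by (intro C_upto_SucI[where D = "\<lambda>v x. 0"]) auto
qed (simp add: C_upto_0)

lemma C_upto_add:
  "open U \<Longrightarrow> C_upto k U f \<Longrightarrow> C_upto k U g \<Longrightarrow> C_upto k U (\<lambda>x. f x + g x)"
proof (induction k arbitrary: f g)
  case (Suc k)
  show ?case
  proof (rule C_upto_SucI[where D = "\<lambda>v x. dir_deriv v f x + dir_deriv v g x"])
    fix x assume "x \<in> U"
    then show "((\<lambda>x. f x + g x) has_derivative (\<lambda>v. dir_deriv v f x + dir_deriv v g x)) (at x)"
      using Suc.prems by (intro has_derivative_add C_upto_has_derivative)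
  qed (use Suc in \<open>auto simp: C_upto_Suc\<close>)
qed (auto simp: C_upto_0)

lemma C_upto_mult:
  "open U \<Longrightarrow> C_upto k U f \<Longrightarrow> C_upto k U g \<Longrightarrow> C_upto k U (\<lambda>x. f x * g x)"
proof (induction k arbitrary: f g)
  case (Suc k)
  show ?case
  proof (rule C_upto_SucI[where D = "\<lambda>v x. f x * dir_deriv v g x + dir_deriv v f x * g x"])
    fix x assume "x \<in> U"
    then show "((\<lambda>x. f x * g x) has_derivative
        (\<lambda>v. f x * dir_deriv v g x + dir_deriv v f x * g x)) (at x)"
      using Suc.prems by (intro has_derivative_mult C_upto_has_derivative)
  next
    fix v
    show "C_upto k U (\<lambda>x. f x * dir_deriv v g x + dir_deriv v f x * g x)"
      using Suc.prems
      by (intro C_upto_add Suc.IH) (auto simp: C_upto_Suc intro: C_upto_SucD)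
  qed (use Suc in auto)
qed (auto simp: C_upto_0)

lemma C_upto_sum:
  assumes "open U" "\<And>i. i \<in> I \<Longrightarrow> C_upto k U (f i)"
  shows "C_upto k U (\<lambda>x. \<Sum>i\<in>I. f i x)"
  using assms(2)
  by (induction I rule: infinite_finite_induct) (auto intro: assms(1) C_upto_const C_upto_add)

lemma C_upto_inverse:
  assumes "open U" "\<And>x. x \<in> U \<Longrightarrow> f x \<noteq> 0"
  shows "C_upto k U f \<Longrightarrow> C_upto k U (\<lambda>x. inverse (f x))"
proof (induction k)
  case 0
  then show ?case using assms by (auto simp: C_upto_0)
next
  case (Suc k)
  have inv: "C_upto k U (\<lambda>x. inverse (f x))"
    using Suc C_upto_SucD by blast
  show ?case
  proof (rule C_upto_SucI[where D = "\<lambda>v x. (-1) * (inverse (f x) * dir_deriv v f x * inverse (f x))"])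
    fix x assume "x \<in> U"
    then show "((\<lambda>x. inverse (f x)) has_derivative
        (\<lambda>v. (-1) * (inverse (f x) * dir_deriv v f x * inverse (f x)))) (at x)"
      using Deriv.has_derivative_inverse[OF _ C_upto_has_derivative[OF Suc.prems, of x]] assms(2) by auto
  next
    fix v
    show "C_upto k U (\<lambda>x. (-1) * (inverse (f x) * dir_deriv v f x * inverse (f x)))"
      using Suc.prems
      by (intro C_upto_mult C_upto_const inv assms) (auto simp: C_upto_Suc)
  qed (rule assms)
qed

text \<open>The chain rule in coordinates, \<open>\<partial>\<^sub>v (f \<circ> \<phi>) = (\<Sum>b. \<partial>\<^sub>v \<phi>\<^sub>b * (\<partial>\<^sub>b f \<circ> \<phi>))\<close>, expresses the derivatives
  of \<open>f \<circ> \<phi>\<close> by composites of lower order with the same \<open>\<phi>\<close>.\<close>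

lemma C_upto_compose:
  fixes f :: "'b::euclidean_space \<Rightarrow> complex" and \<phi> :: "'a::real_normed_vector \<Rightarrow> 'b"
  assumes "open U" "\<And>x. x \<in> U \<Longrightarrow> \<phi> x \<in> V"
  shows "C_upto k V f \<Longrightarrow> (\<And>b. b \<in> Basis \<Longrightarrow> C_upto k U (\<lambda>x. complex_of_real (\<phi> x \<bullet> b)))
    \<Longrightarrow> C_upto k U (\<lambda>x. f (\<phi> x))"
proof (induction k arbitrary: f)
  case 0
  have "f differentiable (at (\<phi> x))" "\<phi> differentiable (at x)" if "x \<in> U" for x
  proof -
    show "f differentiable (at (\<phi> x))" using 0(1) assms(2) that by (auto simp: C_upto_0)
    have "(\<lambda>x. Re (complex_of_real (\<phi> x \<bullet> b))) differentiable (at x)" if "b \<in> Basis" for b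
      using 0(2)[OF that] \<open>x \<in> U\<close> differentiable_chain_at[of "\<lambda>x. complex_of_real (\<phi> x \<bullet> b)" x Re]
      by (auto simp: C_upto_0 o_def bounded_linear_imp_differentiable bounded_linear_Re)
    then show "\<phi> differentiable (at x)"
      by (subst differentiable_componentwise_within) auto
  qed
  then show ?case
    unfolding C_upto_0 using differentiable_chain_at[of \<phi> _ f] by (auto simp: o_def)
next
  case (Suc k)
  let ?c = "\<lambda>b x. complex_of_real (\<phi> x \<bullet> b)"
  show ?case
  proof (rule C_upto_SucI[where D = "\<lambda>v x. \<Sum>b\<in>Basis. dir_deriv v (?c b) x * dir_deriv b f (\<phi> x)"])
    fix x assume x: "x \<in> U"
    have *: "(?c b has_derivative (\<lambda>v. dir_deriv v (?c b) x)) (at x)" if "b \<in> Basis" for b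
      using C_upto_has_derivative Suc.prems(2)[OF that] x by blast
    have re: "((\<lambda>x. \<phi> x \<bullet> b) has_derivative (\<lambda>v. Re (dir_deriv v (?c b) x))) (at x)"
      if "b \<in> Basis" for b
      using has_derivative_Re[OF *[OF that]] by simp
    \<comment> \<open>\<open>C_upto\<close> speaks of complex functions, so the derivatives of the real coordinates come as
      complex numbers and have to be recognized as real.\<close>
    have im: "dir_deriv v (?c b) x = of_real (Re (dir_deriv v (?c b) x))" if "b \<in> Basis" for b v
    proof -
      have "((\<lambda>x. 0) has_derivative (\<lambda>v. Im (dir_deriv v (?c b) x))) (at x)"
        using has_derivative_Im[OF *[OF that]] by simp
      then have "(\<lambda>v. Im (dir_deriv v (?c b) x)) = (\<lambda>v. 0)"
        using has_derivative_unique has_derivative_const by blast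
      then show ?thesis by (metis complex_eq_iff Re_complex_of_real Im_complex_of_real)
    qed
    let ?L = "\<lambda>v. \<Sum>b\<in>Basis. Re (dir_deriv v (?c b) x) *\<^sub>R b"
    have L: "(\<phi> has_derivative ?L) (at x)"
      by (subst has_derivative_componentwise_within) (auto simp: re)
    have df: "(f has_derivative (\<lambda>w. dir_deriv w f (\<phi> x))) (at (\<phi> x))"
      using C_upto_has_derivative Suc.prems(1) x assms(2) by blast
    have "dir_deriv (?L v) f (\<phi> x) = (\<Sum>b\<in>Basis. dir_deriv v (?c b) x * dir_deriv b f (\<phi> x))" for v
    proof -
      interpret linear "\<lambda>w. dir_deriv w f (\<phi> x)"
        using has_derivative_linear[OF df] .
      show ?thesis
        unfolding sum scaleR by (rule sum.cong) (simp_all add: scaleR_conv_of_real flip: im)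
    qed
    then show "((\<lambda>x. f (\<phi> x)) has_derivative
        (\<lambda>v. \<Sum>b\<in>Basis. dir_deriv v (?c b) x * dir_deriv b f (\<phi> x))) (at x)"
      using has_derivative_compose[OF L df] by simp
  next
    fix v
    show "C_upto k U (\<lambda>x. \<Sum>b\<in>Basis. dir_deriv v (?c b) x * dir_deriv b f (\<phi> x))"
    proof (intro C_upto_sum C_upto_mult assms(1))
      fix b :: 'b assume b: "b \<in> Basis"
      show "C_upto k U (dir_deriv v (?c b))" using Suc.prems(2)[OF b] by (simp add: C_upto_Suc)
      show "C_upto k U (\<lambda>x. dir_deriv b f (\<phi> x))"
      proof (rule Suc.IH)
        show "C_upto k V (dir_deriv b f)" using Suc.prems(1) by (simp add: C_upto_Suc)
        show "C_upto k U (\<lambda>x. of_real (\<phi> x \<bullet> b'))" if "b' \<in> Basis" for b'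
          using Suc.prems(2)[OF that] C_upto_SucD by blast
      qed
    qed
  qed (rule assms)
qed

lemma C_upto_bounded_linear:
  fixes L :: "'a::real_normed_vector \<Rightarrow> complex"
  assumes "open U" "bounded_linear L"
  shows "C_upto k U L"
proof (cases k)
  case 0
  then show ?thesis using assms by (auto simp: C_upto_0 bounded_linear_imp_differentiable)
next
  case (Suc j)
  show ?thesis unfolding Suc
    by (rule C_upto_SucI[where D = "\<lambda>v x. L v"])
      (use assms in \<open>auto intro: C_upto_const bounded_linear_imp_has_derivative\<close>)
qed

lemma smooth_open_const: "open U \<Longrightarrow> smooth_open U (\<lambda>x. c)"
  by (simp add: smooth_open_iff_C_upto C_upto_const)

lemma smooth_open_add:
  "open U \<Longrightarrow> smooth_open U f \<Longrightarrow> smooth_open U g \<Longrightarrow> smooth_open U (\<lambda>x. f x + g x)"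
  by (simp add: smooth_open_iff_C_upto C_upto_add)

lemma smooth_open_mult:
  "open U \<Longrightarrow> smooth_open U f \<Longrightarrow> smooth_open U g \<Longrightarrow> smooth_open U (\<lambda>x. f x * g x)"
  by (simp add: smooth_open_iff_C_upto C_upto_mult)

lemma smooth_open_diff:
  assumes "open U" "smooth_open U f" "smooth_open U g"
  shows "smooth_open U (\<lambda>x. f x - g x)"
  using smooth_open_add[OF assms(1,2) smooth_open_mult[OF assms(1) smooth_open_const[OF assms(1), of "-1"] assms(3)]]
  by simp

lemma smooth_open_sum:
  "open U \<Longrightarrow> (\<And>i. i \<in> I \<Longrightarrow> smooth_open U (f i)) \<Longrightarrow> smooth_open U (\<lambda>x. \<Sum>i\<in>I. f i x)"
  by (simp add: smooth_open_iff_C_upto C_upto_sum)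

lemma smooth_open_prod:
  "open U \<Longrightarrow> (\<And>i. i \<in> I \<Longrightarrow> smooth_open U (f i)) \<Longrightarrow> smooth_open U (\<lambda>x. \<Prod>i\<in>I. f i x)"
  by (induction I rule: infinite_finite_induct) (auto intro: smooth_open_const smooth_open_mult)

lemma smooth_open_inverse:
  "open U \<Longrightarrow> smooth_open U f \<Longrightarrow> (\<And>x. x \<in> U \<Longrightarrow> f x \<noteq> 0) \<Longrightarrow> smooth_open U (\<lambda>x. inverse (f x))"
  by (simp add: smooth_open_iff_C_upto C_upto_inverse)

lemma smooth_open_divide:
  assumes "open U" "smooth_open U f" "smooth_open U g" "\<And>x. x \<in> U \<Longrightarrow> g x \<noteq> 0"
  shows "smooth_open U (\<lambda>x. f x / g x)"
  using smooth_open_mult[OF assms(1,2) smooth_open_inverse[OF assms(1,3,4)]]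
  by (simp add: divide_inverse)

lemma smooth_open_compose:
  fixes f :: "'b::euclidean_space \<Rightarrow> complex" and \<phi> :: "'a::real_normed_vector \<Rightarrow> 'b"
  assumes "open U" "\<And>x. x \<in> U \<Longrightarrow> \<phi> x \<in> V" "smooth_open V f"
    and "\<And>b. b \<in> Basis \<Longrightarrow> smooth_open U (\<lambda>x. complex_of_real (\<phi> x \<bullet> b))"
  shows "smooth_open U (\<lambda>x. f (\<phi> x))"
  using assms C_upto_compose[of U \<phi> V] by (simp add: smooth_open_iff_C_upto)

lemma smooth_open_bounded_linear:
  "open U \<Longrightarrow> bounded_linear L \<Longrightarrow> smooth_open U L"
  by (simp add: smooth_open_iff_C_upto C_upto_bounded_linear)

lemma smooth_open_of_real_bounded_linear:
  assumes "open U" "bounded_linear L"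
  shows "smooth_open U (\<lambda>x. complex_of_real (L x))"
  using assms(1) bounded_linear_compose[OF bounded_linear_of_real assms(2)]
  by (rule smooth_open_bounded_linear)

lemma smooth_open_subset: "smooth_open U f \<Longrightarrow> V \<subseteq> U \<Longrightarrow> smooth_open V f"
  unfolding smooth_open_def by blast

lemma smooth_open_cong:
  "open U \<Longrightarrow> smooth_open U f \<Longrightarrow> (\<And>x. x \<in> U \<Longrightarrow> f x = g x) \<Longrightarrow> smooth_open U g"
  unfolding smooth_open_iff_C_upto using C_upto_cong by blast

lemma smooth_open_continuous_on: "smooth_open U f \<Longrightarrow> continuous_on U f"
  unfolding smooth_open_def
  by (metis continuous_at_imp_continuous_on differentiable_imp_continuous_within iter_deriv.simps(1))

lemma smooth_open_has_derivative:
  "smooth_open U f \<Longrightarrow> x \<in> U \<Longrightarrow> (f has_derivative (\<lambda>v. dir_deriv v f x)) (at x)"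
  unfolding smooth_open_iff_C_upto using C_upto_has_derivative by blast

lemma smooth_open_iter_deriv: "smooth_open U f \<Longrightarrow> smooth_open U (iter_deriv vs f)"
  unfolding smooth_open_def by (metis iter_deriv_append)

lemma smooth_open_locally:
  assumes "\<And>x. x \<in> U \<Longrightarrow> \<exists>V. x \<in> V \<and> smooth_open V f"
  shows "smooth_open U f"
  using assms unfolding smooth_open_def by blast

lemma smooth_open_imp_smooth_on: "open U \<Longrightarrow> smooth_open U f \<Longrightarrow> smooth_on U f"
  unfolding smooth_on_def by blast

lemma smooth_on_open_iff:
  assumes "open S"
  shows "smooth_on S f \<longleftrightarrow> smooth_open S f"
proof
  assume L: "smooth_on S f"
  show "smooth_open S f"
  proof (rule smooth_open_locally)
    fix x assume x: "x \<in> S"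
    then obtain U h where U: "open U" "x \<in> U" "smooth_open U h" "\<forall>y\<in>U \<inter> S. h y = f y"
      using L unfolding smooth_on_def by blast
    then have "smooth_open (U \<inter> S) f"
      using assms smooth_open_subset[OF U(3), of "U \<inter> S"] 
      by (intro smooth_open_cong[of "U \<inter> S" h f]) auto
    then show "\<exists>V. x \<in> V \<and> smooth_open V f" using U x by blast
  qed
qed (use assms smooth_open_imp_smooth_on in blast)

lemma smooth_open_sgn:
  fixes r :: "'a::real_normed_vector \<Rightarrow> real"
  assumes "open U" "smooth_open U (\<lambda>x. complex_of_real (r x))" "\<And>x. x \<in> U \<Longrightarrow> r x \<noteq> 0"
  shows "smooth_open U (\<lambda>x. complex_of_real (sgn (r x)))"
proof (rule smooth_open_locally)
  fix x assume x: "x \<in> U"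
  have "continuous_on U (\<lambda>x. Re (complex_of_real (r x)))"
    by (intro continuous_intros smooth_open_continuous_on assms)
  then have "open (U \<inter> (\<lambda>x. Re (complex_of_real (r x))) -` {y. 0 < y * r x})"
    by (rule continuous_open_preimage) (auto intro!: assms open_Collect_less continuous_intros)
  moreover have "x \<in> U \<inter> (\<lambda>x. Re (complex_of_real (r x))) -` {y. 0 < y * r x}"
    using x assms(3) by (simp add: zero_less_mult_iff) (meson linorder_neqE_linordered_idom)
  ultimately show "\<exists>V. x \<in> V \<and> smooth_open V (\<lambda>x. complex_of_real (sgn (r x)))"
    by (intro exI[of _ "U \<inter> (\<lambda>x. Re (complex_of_real (r x))) -` {y. 0 < y * r x}"] conjI
        smooth_open_cong[OF _ smooth_open_const[of _ "complex_of_real (sgn (r x))"]])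
      (auto simp: zero_less_mult_iff)
qed

lemma smooth_open_sign_pow:
  assumes "open U" "smooth_open U (\<lambda>x. complex_of_real (r x))" "\<And>x. x \<in> U \<Longrightarrow> r x \<noteq> 0"
  shows "smooth_open U (\<lambda>x. sign_pow (sgn (r x)) e)"
  using smooth_open_sgn[OF assms] smooth_open_const[OF assms(1)]
  by (cases "e = 0") (auto simp: sign_pow_def)

text \<open>Near \<open>x\<close> the absolute value of \<open>r\<close> is \<open>r\<close> times the constant \<open>sgn (r x)\<close>. This product is
  positive there, so the principal branch of the power can be differentiated.\<close>

lemma has_derivative_of_real_abs_powr:
  fixes r :: "'a::real_normed_vector \<Rightarrow> real"
  assumes "(r has_derivative r') (at x)" "r x \<noteq> 0"
  shows "((\<lambda>x. of_real \<bar>r x\<bar> powr l) has_derivative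
     (\<lambda>v. l * of_real (r' v) * inverse (of_real (r x)) * of_real \<bar>r x\<bar> powr (l::complex))) (at x)"
proof -
  have "((\<lambda>x. complex_of_real (r x * sgn (r x0))) has_derivative
      (\<lambda>v. complex_of_real (r' v * sgn (r x0)))) (at x)" for x0
    by (intro has_derivative_of_real has_derivative_mult_left assms)
  note d = this[of x]
  have p: "complex_of_real (r x * sgn (r x)) \<notin> \<real>\<^sub>\<le>\<^sub>0"
    using assms(2) by (simp add: abs_sgn [symmetric])
  have "((\<lambda>z. z powr l) has_field_derivative
      (l * complex_of_real (r x * sgn (r x)) powr (l - 1))) (at (complex_of_real (r x * sgn (r x))))"
    by (rule has_field_derivative_powr) (use p in auto)
  then have "((\<lambda>y. complex_of_real (r y * sgn (r x)) powr l) has_derivative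
      (\<lambda>v. l * complex_of_real (r x * sgn (r x)) powr (l - 1) * complex_of_real (r' v * sgn (r x)))) (at x)"
    using has_derivative_compose[OF d] unfolding has_field_derivative_def by blast
  moreover have "l * complex_of_real (r x * sgn (r x)) powr (l - 1) * complex_of_real (r' v * sgn (r x))
      = l * of_real (r' v) * inverse (of_real (r x)) * of_real \<bar>r x\<bar> powr l" for v
    using assms(2)
    by (simp add: powr_diff abs_sgn[symmetric]) (cases "r x > 0"; simp add: field_simps)
  ultimately have *: "((\<lambda>y. complex_of_real (r y * sgn (r x)) powr l) has_derivative
     (\<lambda>v. l * of_real (r' v) * inverse (of_real (r x)) * of_real \<bar>r x\<bar> powr l)) (at x)"
    by (simp only:)
  have "continuous (at x) r" using assms(1) has_derivative_continuous by blast
  then have "((\<lambda>y. r y * r x) \<longlongrightarrow> r x * r x) (at x)"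
    by (intro tendsto_intros) (simp add: isCont_def)
  moreover have "0 < r x * r x" using assms(2) by (simp add: zero_less_mult_iff) linarith
  ultimately have "\<forall>\<^sub>F y in at x. 0 < r y * r x"
    by (rule order_tendstoD)
  then have "\<forall>\<^sub>F y in at x. complex_of_real (r y * sgn (r x)) powr l = of_real \<bar>r y\<bar> powr l"
    by eventually_elim (auto simp: zero_less_mult_iff)
  with * show ?thesis
    by (rule has_derivative_transform_eventually) (simp_all add: abs_sgn)
qed

text \<open>The function is reproduced by differentiation up to the factor \<open>l * \<partial>\<^sub>v r / r\<close>, which is smooth;
  this drives the induction on the order.\<close>

lemma smooth_open_abs_powr:
  fixes r :: "'a::real_normed_vector \<Rightarrow> real"
  assumes "open U" "smooth_open U (\<lambda>x. complex_of_real (r x))" "\<And>x. x \<in> U \<Longrightarrow> r x \<noteq> 0"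
  shows "smooth_open U (\<lambda>x. of_real \<bar>r x\<bar> powr (l::complex))"
proof -
  let ?f = "\<lambda>x. of_real \<bar>r x\<bar> powr (l::complex)"
  let ?r = "\<lambda>x. complex_of_real (r x)"
  have dre: "(r has_derivative (\<lambda>v. Re (dir_deriv v ?r x))) (at x)" if "x \<in> U" for x
    using has_derivative_Re[OF smooth_open_has_derivative[OF assms(2) that]] by simp
  have im: "of_real (Re (dir_deriv v ?r x)) = dir_deriv v ?r x" if "x \<in> U" for v x
    using has_derivative_of_real[OF dre[OF that]] smooth_open_has_derivative[OF assms(2) that]
      has_derivative_unique by metis
  have d: "(?f has_derivative
     (\<lambda>v. l * dir_deriv v ?r x * inverse (of_real (r x)) * ?f x)) (at x)" if "x \<in> U" for x
    using has_derivative_of_real_abs_powr[OF dre[OF that] assms(3)[OF that]] im[OF that] by simp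
  have "C_upto k U ?f" for k
  proof (induction k)
    case 0
    then show ?case using d by (auto simp: C_upto_0 differentiable_def)
  next
    case (Suc k)
    have "C_upto (Suc k) U ?r" for k using assms(2) by (simp add: smooth_open_iff_C_upto)
    then show ?case
      using assms(1,3) Suc
      by (intro C_upto_SucI[where D = "\<lambda>v x. l * dir_deriv v ?r x * inverse (of_real (r x)) * ?f x"]
          d C_upto_mult C_upto_const C_upto_inverse)
        (auto simp: C_upto_Suc intro: C_upto_SucD)
  qed
  then show ?thesis by (simp add: smooth_open_iff_C_upto)
qed

lemma smooth_open_of_real_nth2:
  "open U \<Longrightarrow> smooth_open U (\<lambda>g::real^'n^'m. complex_of_real (g$i$j))"
  by (intro smooth_open_of_real_bounded_linear 
      bounded_linear_compose[OF bounded_linear_vec_nth bounded_linear_vec_nth])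

lemma iter_deriv_affine:
  fixes L :: "'a::real_normed_vector \<Rightarrow> 'b::real_normed_vector"
  assumes "smooth_open V f" "bounded_linear L" "open U" "\<And>x. x \<in> U \<Longrightarrow> c + L x \<in> V"
  shows "x \<in> U \<Longrightarrow> iter_deriv vs (\<lambda>x. f (c + L x)) x = iter_deriv (map L vs) f (c + L x)"
proof (induction vs arbitrary: x)
  case (Cons v vs)
  let ?G = "iter_deriv (map L vs) f"
  have "(?G has_derivative (\<lambda>w. dir_deriv w ?G (c + L x))) (at (c + L x))"
    using smooth_open_has_derivative[OF smooth_open_iter_deriv[OF assms(1)]] assms(4) Cons.prems
    by blast
  moreover have "((\<lambda>x. c + L x) has_derivative L) (at x)"
    using has_derivative_add[OF has_derivative_const bounded_linear_imp_has_derivative[OF assms(2)]]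
    by simp
  ultimately have "((\<lambda>x. ?G (c + L x)) has_derivative (\<lambda>w. dir_deriv (L w) ?G (c + L x))) (at x)"
    using has_derivative_compose by blast
  then have "(iter_deriv vs (\<lambda>x. f (c + L x)) has_derivative
      (\<lambda>w. dir_deriv (L w) ?G (c + L x))) (at x)"
    by (rule has_derivative_transform_within_open[OF _ assms(3)]) (use Cons in auto)
  from frechet_derivative_at[OF this, symmetric] show ?case
    by (simp add: dir_deriv_def)
qed simp

lemma iter_deriv_scale:
  assumes "open U" "smooth_open U f"
  shows "x \<in> U \<Longrightarrow> iter_deriv (map (\<lambda>v. s v *\<^sub>R v) vs) f x
    = of_real (\<Prod>v\<leftarrow>vs. s v) * iter_deriv vs f x"
proof (induction vs arbitrary: x)
  case (Cons v vs)
  let ?G = "iter_deriv vs f" and ?C = "complex_of_real (\<Prod>v\<leftarrow>vs. s v)"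
  have G: "(?G has_derivative (\<lambda>w. dir_deriv w ?G x)) (at x)"
    using smooth_open_has_derivative[OF smooth_open_iter_deriv[OF assms(2)]] Cons.prems by blast
  interpret linear "\<lambda>w. dir_deriv w ?G x" using has_derivative_linear[OF G] .
  have "((\<lambda>x. ?C * ?G x) has_derivative (\<lambda>w. ?C * dir_deriv w ?G x)) (at x)"
    using has_derivative_mult_right[OF G] .
  then have "(iter_deriv (map (\<lambda>v. s v *\<^sub>R v) vs) f has_derivative (\<lambda>w. ?C * dir_deriv w ?G x)) (at x)"
    by (rule has_derivative_transform_within_open[OF _ assms(1)]) (use Cons in auto)
  from frechet_derivative_at[OF this, symmetric] show ?case
    by (simp add: scaleR scaleR_conv_of_real) (simp add: dir_deriv_def)
qed simp

section \<open>Smooth cutoff functions\<close>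

text \<open>The powers in the denominator make the family closed under differentiation up to linear
  combinations.\<close>

definition flat :: "nat \<Rightarrow> real \<Rightarrow> real" where
  "flat n t = (if t > 0 then exp (- 1 / t) / t ^ n else 0)"

text \<open>The bound comes from \<open>(1 / (t m))\<^sup>m \<le> (1 + 1 / (t m))\<^sup>m \<le> exp (1 / t)\<close> with \<open>m = n + 2\<close>. The two
  spare powers of \<open>t\<close> make the difference quotient of \<open>flat n\<close> at 0 tend to 0.\<close>

lemma flat_le:
  assumes "t > 0"
  shows "flat n t \<le> real (n + 2) ^ (n + 2) * t\<^sup>2"
proof -
  define m where "m = n + 2"
  have "(1 / t / real m) ^ m \<le> (1 + 1 / t / real m) ^ m"
    using assms by (intro power_mono) auto
  also have "\<dots> \<le> exp (1 / t)"
  proof (rule exp_ge_one_plus_x_over_n_power_n)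
    have "0 < 1 / t" using assms by simp
    then show "- real m \<le> 1 / t" by linarith
  qed (simp add: m_def)
  finally have "(1 / t / real m) ^ m * (real m * t) ^ m \<le> exp (1 / t) * (real m * t) ^ m"
    using assms by (intro mult_right_mono) auto
  moreover have "(1 / t / real m) ^ m * (real m * t) ^ m = (1 / t / real m * (real m * t)) ^ m"
    by (rule power_mult_distrib[symmetric])
  moreover have "1 / t / real m * (real m * t) = 1"
    using assms by (simp add: m_def)
  ultimately have "1 \<le> exp (1 / t) * (real m * t) ^ m"
    by simp
  then have "inverse (exp (1 / t)) \<le> (real m * t) ^ m"
    by (simp add: inverse_eq_divide divide_le_eq mult.commute)
  then have "exp (- 1 / t) \<le> real m ^ m * t ^ m"
    by (simp add: exp_minus power_mult_distrib)
  also have "\<dots> = (real m ^ m * t\<^sup>2) * t ^ n"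
    by (simp add: m_def power_add power2_eq_square)
  finally show ?thesis
    using assms by (simp add: flat_def m_def divide_le_eq)
qed

lemma DERIV_flat: "(flat n has_real_derivative (flat (n + 2) t - of_nat n * flat (n + 1) t)) (at t)"
proof -
  consider "t > 0" | "t = 0" | "t < 0" by linarith
  then show ?thesis
  proof cases
    case 1
    have "((\<lambda>t. exp (- 1 / t) / t ^ n) has_real_derivative
        (flat (n + 2) t - of_nat n * flat (n + 1) t)) (at t)"
      using 1 by (auto intro!: derivative_eq_intros simp: flat_def field_simps)
        (cases n; simp add: field_simps power2_eq_square)+
    then show ?thesis
      by (rule has_field_derivative_transform_within_open[OF _ open_greaterThan[of 0]])
        (use 1 in \<open>auto simp: flat_def\<close>)
  next
    case 2
    have "\<bar>flat n h / h\<bar> \<le> real (n + 2) ^ (n + 2) * \<bar>h\<bar>" for h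
    proof (cases "h > 0")
      case True
      then have "flat n h \<ge> 0" by (simp add: flat_def)
      then show ?thesis
        using flat_le[OF True, of n] True
        by (simp add: divide_le_eq power2_eq_square mult.assoc)
    next
      case False
      then have "flat n h = 0" by (simp add: flat_def)
      then show ?thesis by simp
    qed
    then have "\<forall>\<^sub>F h in at 0. norm (flat n h / h) \<le> real (n + 2) ^ (n + 2) * \<bar>h\<bar>"
      by (intro always_eventually allI) (simp only: real_norm_def)
    moreover have "((\<lambda>h. real (n + 2) ^ (n + 2) * \<bar>h\<bar>) \<longlongrightarrow> 0) (at 0)"
      by (intro tendsto_mult_right_zero tendsto_rabs_zero tendsto_ident_at)
    ultimately have "((\<lambda>h. flat n h / h) \<longlongrightarrow> 0) (at 0)"
      by (rule Lim_null_comparison)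
    then show ?thesis
      using 2 by (simp add: DERIV_def flat_def)
  next
    case 3
    have "(flat n has_real_derivative 0) (at t)"
      by (rule has_field_derivative_transform_within_open[OF DERIV_const[of 0] open_lessThan[of 0]])
        (use 3 in \<open>auto simp: flat_def\<close>)
    then show ?thesis using 3 by (simp add: flat_def)
  qed
qed

lemma smooth_open_flat: "smooth_open UNIV (\<lambda>t. complex_of_real (flat n t))"
proof -
  have "C_upto k UNIV (\<lambda>t. complex_of_real (flat n t))" for k
  proof (induction k arbitrary: n)
    case 0
    then show ?case
      using has_derivative_of_real[OF DERIV_flat[unfolded has_field_derivative_def]]
      by (auto simp: C_upto_0 differentiable_def)
  next
    case (Suc k)
    show ?case
    proof (rule C_upto_SucI)
      show "((\<lambda>t. complex_of_real (flat n t)) has_derivative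
         (\<lambda>v. (of_real (flat (n + 2) t) + (- of_nat n) * of_real (flat (n + 1) t)) * of_real v)) (at t)" for t
        using has_derivative_of_real[OF DERIV_flat[unfolded has_field_derivative_def]] by simp
      show "C_upto k UNIV (\<lambda>t. (complex_of_real (flat (n + 2) t)
          + (- of_nat n) * of_real (flat (n + 1) t)) * of_real v)" for v
        by (intro C_upto_mult C_upto_add C_upto_const Suc.IH open_UNIV)
    qed auto
  qed
  then show ?thesis by (simp add: smooth_open_iff_C_upto)
qed

lemma smooth_step:
  "\<exists>s :: real \<Rightarrow> complex. smooth_open UNIV s \<and> (\<forall>t\<le>1. s t = 1) \<and> (\<forall>t\<ge>2. s t = 0)"
proof (intro exI conjI allI impI)
  let ?s = "\<lambda>t. complex_of_real (flat 0 (2 - t)) / (of_real (flat 0 (2 - t)) + of_real (flat 0 (t - 1)))"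
  have nz: "complex_of_real (flat 0 (2 - t)) + of_real (flat 0 (t - 1)) \<noteq> 0" for t
  proof -
    have "flat 0 (2 - t) + flat 0 (t - 1) > 0"
      by (cases "t > 1"; cases "t < 2") (auto simp: flat_def add_pos_pos)
    then show ?thesis by (simp flip: of_real_add)
  qed
  have "smooth_open UNIV (\<lambda>t. complex_of_real (flat 0 (2 - t)))"
    by (rule smooth_open_compose[OF _ _ smooth_open_flat])
      (simp_all add: smooth_open_diff smooth_open_const smooth_open_bounded_linear bounded_linear_of_real)
  moreover have "smooth_open UNIV (\<lambda>t. complex_of_real (flat 0 (t - 1)))"
    by (rule smooth_open_compose[OF _ _ smooth_open_flat])
      (simp_all add: smooth_open_diff smooth_open_const smooth_open_bounded_linear bounded_linear_of_real)
  ultimately show "smooth_open UNIV ?s"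
    by (intro smooth_open_divide smooth_open_add nz open_UNIV)
  show "?s t = 1" if "t \<le> 1" for t
    using that nz[of t] by (simp add: flat_def)
  show "?s t = 0" if "t \<ge> 2" for t
    using that by (simp add: flat_def)
qed

lemma smooth_bump:
  fixes a :: "'a::euclidean_space"
  obtains b :: "'a \<Rightarrow> complex" where "smooth_open UNIV b"
    "\<And>x. norm (x - a) \<le> 1 \<Longrightarrow> b x = 1" "\<And>x. norm (x - a) \<ge> 2 \<Longrightarrow> b x = 0"
proof -
  obtain s :: "real \<Rightarrow> complex" where s: "smooth_open UNIV s" "\<And>t. t \<le> 1 \<Longrightarrow> s t = 1" "\<And>t. t \<ge> 2 \<Longrightarrow> s t = 0"
    using smooth_step by blast
  let ?q = "\<lambda>x. (x - a) \<bullet> (x - a)"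
  show thesis
  proof
    have "smooth_open UNIV (\<lambda>x. \<Sum>b\<in>Basis. (complex_of_real (x \<bullet> b) - of_real (a \<bullet> b)) *
       (complex_of_real (x \<bullet> b) - of_real (a \<bullet> b)))"
      by (intro smooth_open_sum smooth_open_mult smooth_open_diff smooth_open_const open_UNIV
        smooth_open_of_real_bounded_linear bounded_linear_inner_left)
    then have "smooth_open UNIV (\<lambda>x. complex_of_real (?q x))"
      by (subst euclidean_inner) (simp add: inner_diff_left)
    then show "smooth_open UNIV (\<lambda>x. s (?q x))"
      by (intro smooth_open_compose[OF _ _ s(1)]) auto
    show "s (?q x) = 1" if "norm (x - a) \<le> 1" for x
      using that by (intro s(2)) (simp add: dot_square_norm power_le_one)
    show "s (?q x) = 0" if "norm (x - a) \<ge> 2" for x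
      using power_mono[of 2 "norm (x - a)" 2] that by (intro s(3)) (simp add: dot_square_norm)
  qed
qed

section \<open>Characters and translations\<close>

lemma smooth_open_compose_vec:
  fixes f :: "real^'n \<Rightarrow> complex" and \<phi> :: "'a::real_normed_vector \<Rightarrow> real^'n"
  assumes "open U" "\<And>x. x \<in> U \<Longrightarrow> \<phi> x \<in> V" "smooth_open V f"
    and "\<And>i. smooth_open U (\<lambda>x. complex_of_real (\<phi> x $ i))"
  shows "smooth_open U (\<lambda>x. f (\<phi> x))"
  by (rule smooth_open_compose[OF assms(1-3)])
    (auto simp: Basis_vec_def cart_eq_inner_axis[symmetric] assms(4))

lemma smooth_open_compose_matrix:
  fixes f :: "real^'n^'m \<Rightarrow> complex" and \<phi> :: "'a::real_normed_vector \<Rightarrow> real^'n^'m"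
  assumes "open U" "\<And>x. x \<in> U \<Longrightarrow> \<phi> x \<in> V" "smooth_open V f"
    and "\<And>i j. smooth_open U (\<lambda>x. complex_of_real (\<phi> x $ i $ j))"
  shows "smooth_open U (\<lambda>x. f (\<phi> x))"
  by (rule smooth_open_compose[OF assms(1-3)])
    (auto simp: Basis_vec_def inner_axis cart_eq_inner_axis[symmetric] assms(4))

lemma smooth_open_matrix_mult:
  fixes A :: "'a::real_normed_vector \<Rightarrow> real^'n^'m" and B :: "'a \<Rightarrow> real^'k^'n"
  assumes "open U"
    and "\<And>i j. smooth_open U (\<lambda>x. complex_of_real (A x $ i $ j))"
    and "\<And>i j. smooth_open U (\<lambda>x. complex_of_real (B x $ i $ j))"
  shows "smooth_open U (\<lambda>x. complex_of_real ((A x ** B x) $ i $ j))"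
  using assms by (auto simp: matrix_matrix_mult_def intro!: smooth_open_sum smooth_open_mult)

lemma open_GL3: "open (GL :: (real^3^3) set)"
  unfolding GL_def det_3 by (intro open_Collect_neq continuous_intros)

lemma open_GL2: "open (GL :: (real^2^2) set)"
  unfolding GL_def det_2 by (intro open_Collect_neq continuous_intros)

lemma GL_mult: "g \<in> GL \<Longrightarrow> h \<in> GL \<Longrightarrow> g ** h \<in> GL"
  by (simp add: GL_def det_mul)

lemma SL_mult: "g \<in> SL \<Longrightarrow> h \<in> SL \<Longrightarrow> g ** h \<in> SL"
  by (simp add: SL_def det_mul)

lemma SL_subset_GL: "SL \<subseteq> GL"
  by (auto simp: SL_def GL_def)

lemma sign_pow_mult: "sign_pow (a * b) e = sign_pow a e * sign_pow b e"
  by (simp add: sign_pow_def)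

lemma char_GL_mult:
  assumes "\<And>j. r$j$j = p$j$j * q$j$j"
  shows "char_GL \<xi> l r = char_GL \<xi> l p * char_GL \<xi> l q"
proof -
  have "complex_of_real \<bar>a * b\<bar> powr z = of_real \<bar>a\<bar> powr z * of_real \<bar>b\<bar> powr z" for a b z
    using powr_times_real_left[of "of_real \<bar>a\<bar>" "of_real \<bar>b\<bar>" z] by (simp add: abs_mult)
  then show ?thesis
    by (simp add: char_GL_def assms sgn_mult sign_pow_mult prod.distrib)
qed

lemma char_GL_nonzero: "(\<And>j. p$j$j \<noteq> 0) \<Longrightarrow> char_GL \<xi> l p \<noteq> 0"
  by (auto simp: char_GL_def sign_pow_def sgn_if)

lemma sign_pow_one: "sign_pow 1 e = 1"
  by (simp add: sign_pow_def)

lemma char_GL_one: "(\<And>j. p$j$j = 1) \<Longrightarrow> char_GL \<xi> l p = 1"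
  by (simp add: char_GL_def sign_pow_one)

lemma smooth_open_char_GL:
  assumes "open U" "\<And>j. smooth_open U (\<lambda>x. complex_of_real (p x $ j $ j))"
    "\<And>j x. x \<in> U \<Longrightarrow> p x $ j $ j \<noteq> 0"
  shows "smooth_open U (\<lambda>x. char_GL \<xi> l (p x))"
  unfolding char_GL_def
  by (intro smooth_open_mult smooth_open_prod smooth_open_sign_pow smooth_open_abs_powr assms)

lemma induced_translate:
  fixes f :: "real^'n^'n \<Rightarrow> complex"
  assumes "f \<in> induced GL P \<psi>" "h \<in> GL" "open (GL :: (real^'n^'n) set)"
  shows "(\<lambda>g. f (h ** g)) \<in> induced GL P \<psi>"
proof -
  have "smooth_open GL f" using assms by (simp add: induced_def smooth_on_open_iff)
  then have "smooth_open GL (\<lambda>g. f (h ** g))"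
    by (intro smooth_open_compose_matrix[OF assms(3) _ \<open>smooth_open GL f\<close>])
      (auto intro!: smooth_open_matrix_mult smooth_open_const smooth_open_of_real_nth2 assms GL_mult)
  moreover have "h ** g \<in> GL \<longleftrightarrow> g \<in> GL" for g
    using assms(2) by (simp add: GL_def det_mul)
  ultimately show ?thesis
    using assms by (auto simp: induced_def smooth_on_open_iff matrix_mul_assoc)
qed

section \<open>Germs extend to the principal series\<close>

definition diag_mat :: "real^'n \<Rightarrow> real^'n^'n" where
  "diag_mat t = (\<chi> i j. if i = j then t $ i else 0)"

definition minor12 :: "real^3^3 \<Rightarrow> real" where
  "minor12 g = g$1$1 * g$2$2 - g$1$2 * g$2$1"

definition minor13 :: "real^3^3 \<Rightarrow> real" where
  "minor13 g = g$1$1 * g$3$2 - g$1$2 * g$3$1"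

text \<open>The matrices of the form \<open>lower3 y ** p\<close> for invertible upper triangular \<open>p\<close>. If \<open>g\<close> is such a product,
  \<open>cell_coord g = y\<close> and \<open>cell_diag g\<close> is the diagonal part of \<open>p\<close>: multiplication by \<open>p\<close> on the
  right multiplies the leading minors by those of \<open>p\<close> and the first column by \<open>p\<^sub>1\<^sub>1\<close>, so that
  quotients of minors recover both.\<close>

definition big_cell :: "(real^3^3) set" where
  "big_cell = {g. g$1$1 \<noteq> 0 \<and> minor12 g \<noteq> 0 \<and> det g \<noteq> 0}"

definition cell_diag :: "real^3^3 \<Rightarrow> real^3^3" where
  "cell_diag g = diag_mat (vector [g$1$1, minor12 g / g$1$1, det g / minor12 g])"

definition cell_coord :: "real^3^3 \<Rightarrow> real^3" where
  "cell_coord g = vector [g$2$1 / g$1$1, minor13 g / minor12 g,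
     g$3$1 / g$1$1 - (g$2$1 / g$1$1) * (minor13 g / minor12 g) / 2]"

definition from_cell :: "bit^3 \<Rightarrow> complex^3 \<Rightarrow> (real^3 \<Rightarrow> complex) \<Rightarrow> real^3^3 \<Rightarrow> complex" where
  "from_cell \<xi> l F g =
     (if g \<in> big_cell then inverse (char_GL \<xi> l (cell_diag g)) * F (cell_coord g) else 0)"

lemma open_big_cell: "open big_cell"
  unfolding big_cell_def minor12_def det_3
  by (intro open_Collect_conj open_Collect_neq continuous_intros)

lemma cell_diag_nonzero: "g \<in> big_cell \<Longrightarrow> cell_diag g $ j $ j \<noteq> 0"
  using exhaust_3[of j] by (auto simp: cell_diag_def diag_mat_def big_cell_def)

lemma lower3_in_cell:
  "lower3 y \<in> big_cell" "cell_coord (lower3 y) = y" "char_GL \<xi> l (cell_diag (lower3 y)) = 1"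
proof -
  have *: "det (lower3 y) = 1" "minor12 (lower3 y) = 1" "minor13 (lower3 y) = y$2"
    by (simp_all add: lower3_def det_3 minor12_def minor13_def)
  show "lower3 y \<in> big_cell" using * by (simp add: big_cell_def lower3_def)
  show "cell_coord (lower3 y) = y"
    unfolding cell_coord_def * by (simp add: vec_eq_iff forall_3 lower3_def)
  show "char_GL \<xi> l (cell_diag (lower3 y)) = 1"
    unfolding cell_diag_def *
  proof (rule char_GL_one)
    fix j :: 3 show "diag_mat (vector [lower3 y $ 1 $ 1, 1 / lower3 y $ 1 $ 1, 1 / 1]) $ j $ j = 1"
      using exhaust_3[of j] by (auto simp: diag_mat_def lower3_def)
  qed
qed

lemma cell_mult_upper:
  assumes "g \<in> GL" "p \<in> GL \<inter> upper3"
  shows "g ** p \<in> big_cell \<longleftrightarrow> g \<in> big_cell"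
    and "cell_coord (g ** p) = cell_coord g"
    and "char_GL \<xi> l (cell_diag (g ** p)) = char_GL \<xi> l (cell_diag g) * char_GL \<xi> l p"
proof -
  have up: "p$2$1 = 0" "p$3$1 = 0" "p$3$2 = 0" using assms by (auto simp: upper3_def)
  have dp: "det p = p$1$1 * p$2$2 * p$3$3" by (simp add: det_3 up)
  then have nz: "p$1$1 \<noteq> 0" "p$2$2 \<noteq> 0" "p$3$3 \<noteq> 0" using assms by (auto simp: GL_def)
  have e: "(g ** p)$i$1 = g$i$1 * p$1$1" "(g ** p)$i$2 = g$i$1 * p$1$2 + g$i$2 * p$2$2" for i
    by (simp_all add: matrix_matrix_mult_def sum_3 up)
  have m: "minor12 (g ** p) = minor12 g * (p$1$1 * p$2$2)"
    "minor13 (g ** p) = minor13 g * (p$1$1 * p$2$2)"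
    unfolding minor12_def minor13_def e by (simp_all add: algebra_simps)
  have d: "det (g ** p) = det g * (p$1$1 * p$2$2 * p$3$3)" by (simp add: det_mul dp)
  show "g ** p \<in> big_cell \<longleftrightarrow> g \<in> big_cell"
    using nz by (simp add: big_cell_def e m d)
  show "cell_coord (g ** p) = cell_coord g"
    unfolding cell_coord_def e m using nz by simp
  show "char_GL \<xi> l (cell_diag (g ** p)) = char_GL \<xi> l (cell_diag g) * char_GL \<xi> l p"
  proof (rule char_GL_mult)
    fix j show "cell_diag (g ** p) $ j $ j = cell_diag g $ j $ j * p $ j $ j"
      using exhaust_3[of j] nz
      by (auto simp: cell_diag_def diag_mat_def e m d)
  qed
qed

lemma smooth_open_det3: "open U \<Longrightarrow> smooth_open U (\<lambda>g::real^3^3. complex_of_real (det g))"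
  unfolding det_3 of_real_add of_real_diff of_real_mult
  by (intro smooth_open_add smooth_open_diff smooth_open_mult smooth_open_of_real_nth2)

lemma smooth_open_minor:
  assumes "open U"
  shows "smooth_open U (\<lambda>g. complex_of_real (minor12 g))"
    and "smooth_open U (\<lambda>g. complex_of_real (minor13 g))"
  unfolding minor12_def minor13_def of_real_add of_real_diff of_real_mult
  by (intro smooth_open_add smooth_open_diff smooth_open_mult smooth_open_of_real_nth2 assms)+

lemma smooth_open_from_cell:
  assumes "smooth_open UNIV F"
  shows "smooth_open big_cell (from_cell \<xi> l F)"
proof -
  note sm = smooth_open_mult smooth_open_divide smooth_open_of_real_nth2 smooth_open_const
    smooth_open_diff open_big_cell smooth_open_minor smooth_open_det3
  have 1: "smooth_open big_cell (\<lambda>g. complex_of_real (cell_diag g $ j $ j))" for j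
    using exhaust_3[of j]
    by (elim disjE; simp add: cell_diag_def diag_mat_def; intro sm; simp add: big_cell_def)
  have 2: "smooth_open big_cell (\<lambda>g. complex_of_real (cell_coord g $ j))" for j
    using exhaust_3[of j]
    by (elim disjE; simp add: cell_coord_def; intro sm; simp add: big_cell_def)
  have "smooth_open big_cell (\<lambda>g. inverse (char_GL \<xi> l (cell_diag g)) * F (cell_coord g))"
    by (intro smooth_open_mult smooth_open_inverse smooth_open_char_GL 1
      smooth_open_compose_vec[OF _ _ assms] 2 open_big_cell cell_diag_nonzero char_GL_nonzero) auto
  then show ?thesis
    by (rule smooth_open_cong[OF open_big_cell]) (simp add: from_cell_def)
qed

text \<open>On the big cell \<open>from_cell\<close> is a composite of smooth functions. The remaining points of \<open>GL\<close> must
  have neighbourhoods on which it vanishes. Its support lies in the closed set \<open>K\<close>, where the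
  numerators of the coordinates are bounded by multiples of the denominators; if a denominator
  vanishes on \<open>K\<close>, the numerators do as well and the determinant is 0. So \<open>K\<close> meets \<open>GL\<close> only in
  the big cell.\<close>

lemma from_cell_in_I_GL:
  assumes F: "smooth_open UNIV F" and supp: "\<And>y. F y \<noteq> 0 \<Longrightarrow> norm y \<le> C"
  shows "from_cell \<xi> l F \<in> I_GL \<xi> l"
  unfolding I_GL_def induced_def mem_Collect_eq
proof (intro conjI allI impI ballI)
  fix g :: "real^3^3" assume "g \<notin> GL"
  then show "from_cell \<xi> l F g = 0" by (auto simp: GL_def from_cell_def big_cell_def)
next
  fix g p :: "real^3^3" assume "g \<in> GL" "p \<in> GL \<inter> upper3"
  from cell_mult_upper[OF this] show "from_cell \<xi> l F (g ** p) = inverse (char_GL \<xi> l p) * from_cell \<xi> l F g"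
    by (simp add: from_cell_def)
next
  \<comment> \<open>The third coordinate is \<open>g\<^sub>3\<^sub>1 / g\<^sub>1\<^sub>1 - y\<^sub>1 y\<^sub>2 / 2\<close>, hence the constant \<open>C + C * C / 2\<close>.\<close>
  define K :: "(real^3^3) set" where
    "K = {g. \<bar>g$2$1\<bar> \<le> C * \<bar>g$1$1\<bar> \<and> \<bar>g$3$1\<bar> \<le> (C + C * C / 2) * \<bar>g$1$1\<bar> \<and> \<bar>minor13 g\<bar> \<le> C * \<bar>minor12 g\<bar>}"
  have "closed K"
    unfolding K_def minor12_def minor13_def
    by (intro closed_Collect_conj closed_Collect_le continuous_intros)
  have K: "from_cell \<xi> l F g = 0" if "g \<notin> K" for g
  proof (rule ccontr)
    assume "from_cell \<xi> l F g \<noteq> 0"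
    then have g: "g \<in> big_cell" and "F (cell_coord g) \<noteq> 0"
      by (auto simp: from_cell_def split: if_splits)
    then have c: "\<bar>cell_coord g $ j\<bar> \<le> C" for j
      using supp component_le_norm_cart order_trans by blast
    let ?a = "g$2$1 / g$1$1" and ?b = "minor13 g / minor12 g"
    have ab: "\<bar>?a\<bar> \<le> C" "\<bar>?b\<bar> \<le> C" "\<bar>g$3$1 / g$1$1 - ?a * ?b / 2\<bar> \<le> C"
      using c[of 1] c[of 2] c[of 3] by (simp_all add: cell_coord_def)
    have "\<bar>?a * ?b\<bar> \<le> C * C"
      using ab by (subst abs_mult) (intro mult_mono, auto)
    moreover have "\<bar>x\<bar> \<le> C + B / 2" if "\<bar>y\<bar> \<le> B" "\<bar>x - y / 2\<bar> \<le> C" for x y B :: real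
      using that by linarith
    ultimately have "\<bar>g$3$1 / g$1$1\<bar> \<le> C + C * C / 2" using ab(3) by blast
    with ab that g show False
      by (simp add: K_def big_cell_def abs_divide divide_le_eq)
  qed
  have sub: "g \<in> big_cell" if "g \<in> GL" "g \<in> K" for g
  proof -
    have "g$1$1 \<noteq> 0"
    proof
      assume "g$1$1 = 0"
      with that(2) have "g$2$1 = 0" "g$3$1 = 0" by (auto simp: K_def)
      with \<open>g$1$1 = 0\<close> that(1) show False by (simp add: GL_def det_3)
    qed
    moreover have "minor12 g \<noteq> 0"
    proof
      assume "minor12 g = 0"
      moreover from this that(2) have "minor13 g = 0" by (auto simp: K_def)
      moreover have "det g * g$1$1 = minor12 g * (g$1$1 * g$3$3 - g$1$3 * g$3$1)
          - minor13 g * (g$1$1 * g$2$3 - g$1$3 * g$2$1)"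
        unfolding det_3 minor12_def minor13_def by algebra
      ultimately show False using that(1) \<open>g$1$1 \<noteq> 0\<close> by (simp add: GL_def)
    qed
    ultimately show ?thesis using that(1) by (simp add: big_cell_def GL_def)
  qed
  have "smooth_open GL (from_cell \<xi> l F)"
  proof (rule smooth_open_locally)
    fix g :: "real^3^3" assume "g \<in> GL"
    show "\<exists>V. g \<in> V \<and> smooth_open V (from_cell \<xi> l F)"
    proof (cases "g \<in> K")
      case True
      then show ?thesis using sub \<open>g \<in> GL\<close> smooth_open_from_cell[OF F] by blast
    next
      case False
      have "smooth_open (- K) (from_cell \<xi> l F)"
        using \<open>closed K\<close> K by (intro smooth_open_cong[OF _ smooth_open_const[of _ 0]]) auto
      then show ?thesis using False by blast
    qed
  qed
  then show "smooth_on GL (from_cell \<xi> l F)"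
    using open_GL3 smooth_open_imp_smooth_on by blast
qed

lemma I_GL_local_extension:
  assumes F: "smooth_open UNIV F"
  shows "\<exists>f\<in>I_GL \<xi> l. \<forall>\<^sub>F y in nhds a. f (lower3 y) = F y"
proof -
  obtain b where b: "smooth_open UNIV b" "\<And>x. norm (x - a) \<le> 1 \<Longrightarrow> b x = 1"
    "\<And>x. norm (x - a) \<ge> 2 \<Longrightarrow> b x = 0"
    using smooth_bump[of a] by blast
  let ?f = "from_cell \<xi> l (\<lambda>y. b y * F y)"
  have "?f \<in> I_GL \<xi> l"
  proof (rule from_cell_in_I_GL)
    show "smooth_open UNIV (\<lambda>y. b y * F y)" by (intro smooth_open_mult b F open_UNIV)
    fix y assume "b y * F y \<noteq> 0"
    then have "norm (y - a) < 2" using b(3)[of y] by fastforce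
    then show "norm y \<le> norm a + 2" using norm_triangle_sub[of y a] by linarith
  qed
  moreover have "\<forall>\<^sub>F y in nhds a. ?f (lower3 y) = F y"
    unfolding eventually_nhds
    by (intro exI[of _ "ball a 1"])
      (auto simp: from_cell_def lower3_in_cell b(2) dist_norm norm_minus_commute)
  ultimately show ?thesis by blast
qed

section \<open>The torus action on jets\<close>

definition jet :: "(nat^3) set \<Rightarrow> (nat^3 \<Rightarrow> complex) \<Rightarrow> (real^3^3 \<Rightarrow> complex) \<Rightarrow> complex" where
  "jet S c f = (\<Sum>\<alpha>\<in>S. c \<alpha> * partial \<alpha> (\<lambda>y. f (lower3 y)) 0)"

text \<open>The monomial \<open>\<partial>\<^sup>\<alpha>\<close> in \<open>E\<^sub>2\<^sub>1, E\<^sub>3\<^sub>2, E\<^sub>3\<^sub>1\<close> has torus weight \<open>\<alpha>\<^sub>1 \<beta>\<^sub>1 + \<alpha>\<^sub>2 \<beta>\<^sub>2 + \<alpha>\<^sub>3 (\<beta>\<^sub>1 + \<beta>\<^sub>2)\<close> for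
  the negative simple roots \<open>\<beta>\<^sub>1, \<beta>\<^sub>2\<close>; these are its coefficients.\<close>

definition weight :: "nat^3 \<Rightarrow> nat \<times> nat" where
  "weight \<alpha> = (\<alpha>$1 + \<alpha>$3, \<alpha>$2 + \<alpha>$3)"

text \<open>The values of the negative roots on \<open>diag_mat t\<close>, in the order of the coordinates of \<open>lower3\<close>.\<close>

definition root_val :: "real^3 \<Rightarrow> real^3" where
  "root_val t = vector [t$2 / t$1, t$3 / t$2, t$3 / t$1]"

lemma diag_mat_nth [simp]: "diag_mat t $ i $ j = (if i = j then t $ i else 0)"
  by (simp add: diag_mat_def)

lemma diag_mat_mult_nth:
  fixes g :: "real^'n^'n"
  shows "(diag_mat t ** g) $ i $ j = t $ i * g $ i $ j" "(g ** diag_mat t) $ i $ j = g $ i $ j * t $ j"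
  by (simp_all add: matrix_matrix_mult_def if_distrib if_distribR cong: if_cong)

lemma det_diag_mat: "det (diag_mat t) = (\<Prod>i\<in>UNIV. t $ i)"
  by (subst det_diagonal) auto

lemma diag_mat_GL: "(\<And>j. t $ j \<noteq> 0) \<Longrightarrow> diag_mat t \<in> GL"
  by (simp add: GL_def det_diag_mat)

lemma diag_mat_upper3: "diag_mat t \<in> upper3"
  by (simp add: upper3_def)

lemma lower3_nth:
  "lower3 y $ 1 $ 1 = 1" "lower3 y $ 1 $ 2 = 0" "lower3 y $ 1 $ 3 = 0"
  "lower3 y $ 2 $ 1 = y$1" "lower3 y $ 2 $ 2 = 1" "lower3 y $ 2 $ 3 = 0"
  "lower3 y $ 3 $ 1 = y$3 + y$1 * y$2 / 2" "lower3 y $ 3 $ 2 = y$2" "lower3 y $ 3 $ 3 = 1"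
  by (simp_all add: lower3_def)

lemma diag_mat_lower3:
  assumes "\<And>j. t $ j \<noteq> 0"
  shows "diag_mat t ** lower3 y = lower3 (\<chi> j. root_val t $ j * y $ j) ** diag_mat t"
  using assms
  by (simp add: vec_eq_iff forall_3 diag_mat_mult_nth lower3_nth root_val_def field_simps)

lemma lower3_GL: "lower3 y \<in> GL" and lower3_SL: "lower3 y \<in> SL"
  by (simp_all add: GL_def SL_def det_3 lower3_def)

lemma smooth_open_lower3_nth:
  fixes \<phi> :: "'a::real_normed_vector \<Rightarrow> real^3"
  assumes "open U" "\<And>j. smooth_open U (\<lambda>x. complex_of_real (\<phi> x $ j))"
  shows "smooth_open U (\<lambda>x. complex_of_real (lower3 (\<phi> x) $ i $ j))"
  using exhaust_3[of i] exhaust_3[of j]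
  by (elim disjE; simp add: lower3_nth;
      intro smooth_open_add smooth_open_divide smooth_open_mult smooth_open_const assms; simp)

lemma I_GL_D:
  assumes "f \<in> I_GL \<xi> l"
  shows "smooth_open GL f" "\<And>g p. g \<in> GL \<Longrightarrow> p \<in> GL \<Longrightarrow> p \<in> upper3 \<Longrightarrow> f (g ** p) = inverse (char_GL \<xi> l p) * f g"
    "\<And>g. g \<notin> GL \<Longrightarrow> f g = 0"
  using assms open_GL3 by (auto simp: I_GL_def induced_def smooth_on_open_iff)

lemma I_GL_translate: "f \<in> I_GL \<xi> l \<Longrightarrow> h \<in> GL \<Longrightarrow> (\<lambda>g. f (h ** g)) \<in> I_GL \<xi> l"
  unfolding I_GL_def using induced_translate open_GL3 by blast

lemma smooth_open_lower3:
  assumes "f \<in> I_GL \<xi> l"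
  shows "smooth_open UNIV (\<lambda>y. f (lower3 y))"
  by (intro smooth_open_compose_matrix[OF _ _ I_GL_D(1)[OF assms]] smooth_open_lower3_nth
      smooth_open_of_real_bounded_linear bounded_linear_vec_nth open_UNIV lower3_GL)

lemma partial_scale:
  assumes "smooth_open UNIV F"
  shows "partial \<alpha> (\<lambda>y. F (\<chi> j. r $ j * y $ j)) y =
    of_real (r$1 ^ \<alpha>$1 * r$2 ^ \<alpha>$2 * r$3 ^ \<alpha>$3) * partial \<alpha> F (\<chi> j. r $ j * y $ j)"
proof -
  let ?L = "\<lambda>y::real^3. (\<chi> j. r $ j * y $ j) :: real^3"
  let ?vs = "replicate (\<alpha>$1) (axis 1 1) @ replicate (\<alpha>$2) (axis 2 1) @ replicate (\<alpha>$3) (axis 3 1) :: (real^3) list"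
  have L: "bounded_linear ?L"
    by (auto simp: linear_conv_bounded_linear[symmetric] linear_iff vec_eq_iff algebra_simps)
  have "?L (axis j 1) = (r \<bullet> axis j 1) *\<^sub>R axis j 1" for j
    by (subst inner_axis) (simp add: vec_eq_iff axis_def)
  then have map: "map ?L ?vs = map (\<lambda>v. (r \<bullet> v) *\<^sub>R v) ?vs"
    by simp
  have "iter_deriv ?vs (\<lambda>y. F (0 + ?L y)) y = iter_deriv (map ?L ?vs) F (0 + ?L y)"
    by (rule iter_deriv_affine[OF assms L open_UNIV]) auto
  also have "\<dots> = of_real (\<Prod>v\<leftarrow>?vs. r \<bullet> v) * iter_deriv ?vs F (0 + ?L y)"
    unfolding map by (rule iter_deriv_scale[OF open_UNIV assms]) simp
  finally show ?thesis
    by (simp add: partial_def inner_axis mult.assoc)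
qed

lemma partial_cmult:
  assumes "smooth_open UNIV F"
  shows "partial \<alpha> (\<lambda>y. k * F y) x = k * partial \<alpha> F x"
proof -
  have "iter_deriv vs (\<lambda>y. k * F y) = (\<lambda>y. k * iter_deriv vs F y)" for vs
  proof (induction vs)
    case (Cons v vs)
    show ?case
    proof
      fix x
      have "((\<lambda>y. k * iter_deriv vs F y) has_derivative (\<lambda>w. k * dir_deriv w (iter_deriv vs F) x)) (at x)"
        by (intro has_derivative_mult_right smooth_open_has_derivative[OF smooth_open_iter_deriv[OF assms]]) simp
      from frechet_derivative_at[OF this, symmetric]
      show "iter_deriv (v # vs) (\<lambda>y. k * F y) x = k * iter_deriv (v # vs) F x"
        by (simp add: Cons dir_deriv_def)
    qed
  qed simp
  then show ?thesis by (simp add: partial_def)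
qed

lemma partial_diag:
  assumes f: "f \<in> I_GL \<xi> l" and t: "\<And>j. t $ j \<noteq> 0" and w: "weight \<alpha> = (a, b)"
  shows "partial \<alpha> (\<lambda>y. f (diag_mat t ** lower3 y)) x = inverse (char_GL \<xi> l (diag_mat t)) *
    of_real ((t$2 / t$1) ^ a * (t$3 / t$2) ^ b) * partial \<alpha> (\<lambda>y. f (lower3 y)) (\<chi> j. root_val t $ j * x $ j)"
proof -
  note sm = smooth_open_lower3[OF f]
  let ?k = "inverse (char_GL \<xi> l (diag_mat t))" and ?r = "root_val t"
  have "f (diag_mat t ** lower3 y) = ?k * f (lower3 (\<chi> j. ?r $ j * y $ j))" for y
    unfolding diag_mat_lower3[OF t]
    by (intro I_GL_D(2)[OF f] lower3_GL diag_mat_GL t diag_mat_upper3)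
  moreover have "smooth_open UNIV (\<lambda>y. f (lower3 (\<chi> j. ?r $ j * y $ j)))"
    by (rule smooth_open_compose_vec[OF _ _ sm])
      (auto intro!: smooth_open_mult smooth_open_const smooth_open_of_real_bounded_linear bounded_linear_vec_nth)
  ultimately have "partial \<alpha> (\<lambda>y. f (diag_mat t ** lower3 y)) x =
      ?k * partial \<alpha> (\<lambda>y. f (lower3 (\<chi> j. ?r $ j * y $ j))) x"
    by (simp add: partial_cmult)
  moreover have "?r$1 ^ \<alpha>$1 * ?r$2 ^ \<alpha>$2 * ?r$3 ^ \<alpha>$3 = (t$2 / t$1) ^ a * (t$3 / t$2) ^ b"
  proof -
    have "?r$3 = (t$2 / t$1) * (t$3 / t$2)" using t by (simp add: root_val_def)
    moreover have "?r$1 = t$2 / t$1" "?r$2 = t$3 / t$2" by (simp_all add: root_val_def)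
    moreover have "a = \<alpha>$1 + \<alpha>$3" "b = \<alpha>$2 + \<alpha>$3" using w by (simp_all add: weight_def)
    ultimately show ?thesis by (simp only: power_add power_mult_distrib mult_ac)
  qed
  ultimately show ?thesis
    using partial_scale[OF sm, of \<alpha> ?r x] by simp
qed

lemma jet_diag:
  assumes "f \<in> I_GL \<xi> l" "\<And>j. t $ j \<noteq> 0"
  shows "jet S c (\<lambda>g. f (diag_mat t ** g)) = inverse (char_GL \<xi> l (diag_mat t)) *
    (\<Sum>\<alpha>\<in>S. of_real ((t$2 / t$1) ^ fst (weight \<alpha>) * (t$3 / t$2) ^ snd (weight \<alpha>)) *
      (c \<alpha> * partial \<alpha> (\<lambda>y. f (lower3 y)) 0))"
proof -
  have "(\<chi> j. root_val t $ j * (0::real^3) $ j) = 0" by (simp add: vec_eq_iff)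
  then show ?thesis
    unfolding jet_def sum_distrib_left
    by (intro sum.cong refl) (simp add: partial_diag[OF assms prod.collapse[symmetric]])
qed

lemma jet_diag_homogeneous:
  assumes "f \<in> I_GL \<xi> l" "\<And>j. t $ j \<noteq> 0" "\<And>\<alpha>. \<alpha> \<in> S \<Longrightarrow> weight \<alpha> = (a, b)"
  shows "jet S c (\<lambda>g. f (diag_mat t ** g)) = inverse (char_GL \<xi> l (diag_mat t)) *
    of_real ((t$2 / t$1) ^ a * (t$3 / t$2) ^ b) * jet S c f"
  unfolding jet_diag[OF assms(1,2)] using assms(3)
  by (simp add: jet_def sum_distrib_left mult.assoc)

section \<open>Isolating one weight\<close>

text \<open>The powers of the diagonal matrix with entries 1, 2, 6. Its root values 2 and 3 are multiplicatively
  independent. It acts on weight \<open>(a, b)\<close> by \<open>2\<^sup>a * 3\<^sup>b\<close>, up to the value of the inducing character,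
  so distinct weights have distinct eigenvalues.\<close>

definition tau :: "nat \<Rightarrow> real^3" where
  "tau k = vector [1, 2 ^ k, 6 ^ k]"

lemma tau_nonzero: "tau k $ j \<noteq> 0"
  using exhaust_3[of j] by (auto simp: tau_def)

lemma two_three_power_inj:
  fixes a b a' b' :: nat
  assumes "2 ^ a * 3 ^ b = (2 ^ a' * 3 ^ b' :: nat)"
  shows "a = a' \<and> b = b'"
proof -
  have *: "a \<le> a'" if "2 ^ a * 3 ^ b = (2 ^ a' * 3 ^ b' :: nat)" for a b a' b' :: nat
  proof -
    have "2 ^ a dvd 2 ^ a' * (3::nat) ^ b'" by (metis that dvd_triv_left)
    moreover have "coprime (2 ^ a) ((3::nat) ^ b')" by simp
    ultimately have "2 ^ a dvd (2::nat) ^ a'" by (simp add: coprime_dvd_mult_left_iff)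
    then show ?thesis by (simp add: dvd_power_iff_le)
  qed
  have "a = a'" using *[OF assms] *[OF assms[symmetric]] by simp
  then show ?thesis using assms by simp
qed

lemma separating_poly:
  fixes d :: complex
  assumes "finite A"
  shows "\<exists>q. poly q d = 1 \<and> (\<forall>z\<in>A. z \<noteq> d \<longrightarrow> poly q z = 0)"
proof -
  let ?p = "\<Prod>z\<in>A - {d}. [:- z, 1:]"
  have "poly ?p d \<noteq> 0" using assms by (auto simp: poly_prod)
  then show ?thesis
    using assms by (intro exI[of _ "smult (inverse (poly ?p d)) ?p"]) (auto simp: poly_prod)
qed

text \<open>The projection to an eigenspace of a diagonalizable operator with finitely many eigenvalues is a
  polynomial in the operator, here in the translation by \<open>diag_mat (tau 1)\<close>. The coefficients \<open>m k\<close>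
  are those of the polynomial, corrected by the value of the character on \<open>tau k\<close>; they do not
  depend on \<open>f\<close>.\<close>

lemma jet_weight_projection:
  assumes "finite S"
  shows "\<exists>n m. \<forall>f\<in>I_GL \<xi> l. jet {\<alpha>\<in>S. weight \<alpha> = w} c f
    = (\<Sum>k<n. m k * jet S c (\<lambda>g. f (diag_mat (tau k) ** g)))"
proof -
  define \<omega> :: "nat \<times> nat \<Rightarrow> complex" where "\<omega> w = of_nat (2 ^ fst w * 3 ^ snd w)" for w
  have inj: "\<omega> w = \<omega> w' \<Longrightarrow> w = w'" for w w'
    using two_three_power_inj unfolding \<omega>_def of_nat_eq_iff by (metis prod_eq_iff)
  obtain q where q: "poly q (\<omega> w) = 1" "\<And>\<alpha>. \<alpha> \<in> S \<Longrightarrow> weight \<alpha> \<noteq> w \<Longrightarrow> poly q (\<omega> (weight \<alpha>)) = 0"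
    using separating_poly[of "(\<lambda>\<alpha>. \<omega> (weight \<alpha>)) ` S" "\<omega> w"] assms inj by (auto; metis)
  let ?n = "Suc (degree q)" and ?m = "\<lambda>k. coeff q k * char_GL \<xi> l (diag_mat (tau k))"
  have "jet {\<alpha>\<in>S. weight \<alpha> = w} c f = (\<Sum>k<?n. ?m k * jet S c (\<lambda>g. f (diag_mat (tau k) ** g)))"
    if f: "f \<in> I_GL \<xi> l" for f
  proof -
    let ?d = "\<lambda>\<alpha>. c \<alpha> * partial \<alpha> (\<lambda>y. f (lower3 y)) 0"
    have nz: "char_GL \<xi> l (diag_mat (tau k)) \<noteq> 0" for k
      by (rule char_GL_nonzero) (simp add: tau_nonzero)
    have left_inverse_mult: "char_GL \<xi> l (diag_mat (tau k)) *
        (inverse (char_GL \<xi> l (diag_mat (tau k))) * z) = z" for k z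
      using nz by (simp flip: mult.assoc)
    have r: "of_real ((tau k $ 2 / tau k $ 1) ^ fst v * (tau k $ 3 / tau k $ 2) ^ snd v) = \<omega> v ^ k" for k v
    proof -
      have "(6::real) ^ k / 2 ^ k = 3 ^ k" by (simp flip: power_divide)
      then show ?thesis
        by (simp add: tau_def \<omega>_def power_mult_distrib mult.commute flip: power_mult)
    qed
    have "(\<Sum>k<?n. ?m k * jet S c (\<lambda>g. f (diag_mat (tau k) ** g)))
        = (\<Sum>k<?n. \<Sum>\<alpha>\<in>S. coeff q k * \<omega> (weight \<alpha>) ^ k * ?d \<alpha>)"
      unfolding jet_diag[OF f tau_nonzero] r using nz
      by (intro sum.cong refl) (simp add: sum_distrib_left mult.assoc left_inverse_mult)
    also have "\<dots> = (\<Sum>\<alpha>\<in>S. poly q (\<omega> (weight \<alpha>)) * ?d \<alpha>)"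
      by (subst sum.swap) (simp add: poly_altdef sum_distrib_right lessThan_Suc_atMost)
    also have "\<dots> = (\<Sum>\<alpha>\<in>S. if weight \<alpha> = w then ?d \<alpha> else 0)"
      using q by (intro sum.cong) auto
    also have "\<dots> = jet {\<alpha>\<in>S. weight \<alpha> = w} c f"
      unfolding jet_def using assms by (simp add: sum.inter_filter)
    finally show ?thesis by simp
  qed
  then show ?thesis
    by (intro exI[of _ ?n] exI[of _ ?m] ballI)
qed

section \<open>The embedded subgroups\<close>

lemma emb_mult: "emb i (g ** h) = emb i g ** emb i h"
  using exhaust_3[of i]
  by (elim disjE; simp add: vec_eq_iff forall_3 emb_def matrix_matrix_mult_def sum_3 sum_2)

lemma emb_one: "emb i (mat 1) = mat 1"
  using exhaust_3[of i]
  by (elim disjE; simp add: vec_eq_iff forall_3 emb_def mat_def)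

lemma det_emb: "det (emb i g) = det g"
  using exhaust_3[of i]
  by (elim disjE; simp add: det_3 det_2 emb_def)

lemma emb_GL: "emb i g \<in> GL \<longleftrightarrow> g \<in> GL"
  by (simp add: GL_def det_emb)

lemma matrix_inv_GL:
  fixes h :: "real^'n^'n"
  assumes "h \<in> GL"
  shows "h ** matrix_inv h = mat 1" "matrix_inv h ** h = mat 1"
proof -
  have "\<exists>k. h ** k = mat 1 \<and> k ** h = mat 1"
    using assms invertible_det_nz[of h] by (simp add: GL_def invertible_def)
  from someI_ex[OF this] show "h ** matrix_inv h = mat 1" "matrix_inv h ** h = mat 1"
    by (simp_all add: matrix_inv_def)
qed

lemma matrix_inv_eqI:
  fixes h k :: "real^'n^'n"
  assumes "h ** k = mat 1"
  shows "matrix_inv h = k"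
proof -
  have "det h * det k = 1" using arg_cong[OF assms, of det] by (simp add: det_mul)
  then have "h \<in> GL" by (auto simp: GL_def)
  from matrix_inv_GL[OF this] show ?thesis
    by (metis assms matrix_mul_assoc matrix_mul_lid matrix_mul_rid)
qed

lemma matrix_inv_emb: "h \<in> GL \<Longrightarrow> matrix_inv (emb i h) = emb i (matrix_inv h)"
  by (rule matrix_inv_eqI) (simp add: matrix_inv_GL emb_one flip: emb_mult)

definition upper_uni :: "real \<Rightarrow> real^2^2" where
  "upper_uni s = vector [vector [1, s], vector [0, 1]]"

text \<open>Conjugation by the torus keeps the one-parameter subgroups of the embedded \<open>SL(2)\<close> and rescales
  their parameter. This holds for all diagonal matrices of \<open>GL(3)\<close>, also for those outside the image
  of \<open>emb i\<close>.\<close>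

lemma emb_lower2_diag:
  assumes "\<And>j. t $ j \<noteq> 0"
  shows "emb i (lower2 x) ** diag_mat t = diag_mat t ** emb i (lower2 (x / root_val t $ i))"
  using exhaust_3[of i] assms
  by (elim disjE; simp add: vec_eq_iff forall_3 diag_mat_mult_nth emb_def lower2_def root_val_def field_simps)

lemma emb_upper_uni_diag:
  assumes "\<And>j. t $ j \<noteq> 0"
  shows "emb i (upper_uni s) ** diag_mat t = diag_mat t ** emb i (upper_uni (s * root_val t $ i))"
  using exhaust_3[of i] assms
  by (elim disjE; simp add: vec_eq_iff forall_3 diag_mat_mult_nth emb_def upper_uni_def root_val_def field_simps)

section \<open>Properties inherited by the weight components\<close>

definition N_invariant :: "3 \<Rightarrow> bit^3 \<Rightarrow> complex^3 \<Rightarrow> (nat^3) set \<Rightarrow> (nat^3 \<Rightarrow> complex) \<Rightarrow> bool" where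
  "N_invariant i \<xi> l S c \<longleftrightarrow>
     (\<forall>f\<in>I_GL \<xi> l. \<forall>s. jet S c (\<lambda>g. f (emb i (upper_uni s) ** g)) = jet S c f)"

text \<open>The values of the associated operator at \<open>lower2 x\<close> are combinations of derivatives at \<open>axis i x\<close>
  with smooth coefficients. This is the condition for a differential operator at the identity
  only; translations carry it to the other points.\<close>

definition jet_local :: "3 \<Rightarrow> bit^3 \<Rightarrow> complex^3 \<Rightarrow> (nat^3) set \<Rightarrow> (nat^3 \<Rightarrow> complex) \<Rightarrow> bool" where
  "jet_local i \<xi> l S c \<longleftrightarrow> (\<exists>U B a. open U \<and> 0 \<in> U \<and> finite B \<and> (\<forall>\<alpha>\<in>B. smooth_on U (a \<alpha>)) \<and>
     (\<forall>f\<in>I_GL \<xi> l. \<forall>x\<in>U. jet S c (\<lambda>g. f (emb i (lower2 x) ** g)) =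
        (\<Sum>\<alpha>\<in>B. a \<alpha> x * partial \<alpha> (\<lambda>y. f (lower3 y)) (axis i x))))"

lemma upper_uni_GL: "upper_uni s \<in> GL" and upper_uni_SL: "upper_uni s \<in> SL"
  by (simp_all add: GL_def SL_def det_2 upper_uni_def)

lemma lower2_GL: "lower2 s \<in> GL" and lower2_SL: "lower2 s \<in> SL"
  by (simp_all add: GL_def SL_def det_2 lower2_def)

lemma tau_GL: "diag_mat (tau k) \<in> GL"
  by (intro diag_mat_GL tau_nonzero)

text \<open>The functionals \<open>f \<mapsto> jet S c (f (t \<cdot>))\<close> are invariant for diagonal \<open>t\<close>, since \<open>t\<close> normalizes the
  unipotent group, and the weight component is a combination of them.\<close>

lemma N_invariant_weight:
  assumes "N_invariant i \<xi> l S c" "finite S"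
  shows "N_invariant i \<xi> l {\<alpha>\<in>S. weight \<alpha> = w} c"
  unfolding N_invariant_def
proof (intro ballI allI)
  fix f s assume f: "f \<in> I_GL \<xi> l"
  obtain n m where proj: "\<And>f. f \<in> I_GL \<xi> l \<Longrightarrow> jet {\<alpha>\<in>S. weight \<alpha> = w} c f
    = (\<Sum>k<n. m k * jet S c (\<lambda>g. f (diag_mat (tau k) ** g)))"
    using jet_weight_projection[OF assms(2), of \<xi> l w c] by blast
  have "jet S c (\<lambda>g. f (emb i (upper_uni s) ** (diag_mat (tau k) ** g)))
      = jet S c (\<lambda>g. f (diag_mat (tau k) ** g))" for k
  proof -
    have "emb i (upper_uni s) ** (diag_mat (tau k) ** g) =
        diag_mat (tau k) ** (emb i (upper_uni (s * root_val (tau k) $ i)) ** g)" for g :: "real^3^3"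
      using emb_upper_uni_diag[OF tau_nonzero] by (simp add: matrix_mul_assoc)
    then show ?thesis
      using assms(1)[unfolded N_invariant_def, rule_format, OF I_GL_translate[OF f tau_GL[of k]],
          of "s * root_val (tau k) $ i"] by simp
  qed
  then show "jet {\<alpha>\<in>S. weight \<alpha> = w} c (\<lambda>g. f (emb i (upper_uni s) ** g))
      = jet {\<alpha>\<in>S. weight \<alpha> = w} c f"
    using f proj I_GL_translate[OF f, of "emb i (upper_uni s)"]
    by (simp add: emb_GL upper_uni_GL)
qed

lemma root_val_tau_nonzero: "root_val (tau k) $ i \<noteq> 0"
  using exhaust_3[of i] tau_nonzero[of k] by (auto simp: root_val_def)

text \<open>Conjugation by \<open>t\<close> turns \<open>lower2 x\<close> into \<open>lower2 (x / r)\<close> for the root value \<open>r\<close>, and the rescaling of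
  the coordinates by \<open>t\<close> sends \<open>axis i (x / r)\<close> back to \<open>axis i x\<close>. So each term of the projection
  evaluates derivatives of \<open>f\<close> at the right point, with coefficients rescaled in \<open>x\<close>. The
  neighbourhood \<open>V\<close> has to be small enough for all the rescalings.\<close>

lemma jet_local_weight:
  assumes "jet_local i \<xi> l S c" "finite S"
  shows "jet_local i \<xi> l {\<alpha>\<in>S. weight \<alpha> = w} c"
proof -
  obtain n m where proj: "\<And>f. f \<in> I_GL \<xi> l \<Longrightarrow> jet {\<alpha>\<in>S. weight \<alpha> = w} c f
    = (\<Sum>k<n. m k * jet S c (\<lambda>g. f (diag_mat (tau k) ** g)))"
    using jet_weight_projection[OF assms(2), of \<xi> l w c] by blast
  obtain U B a where U: "open U" "0 \<in> U" "finite B" "\<And>\<alpha>. \<alpha> \<in> B \<Longrightarrow> smooth_on U (a \<alpha>)"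
    and loc: "\<And>f x. f \<in> I_GL \<xi> l \<Longrightarrow> x \<in> U \<Longrightarrow> jet S c (\<lambda>g. f (emb i (lower2 x) ** g)) =
        (\<Sum>\<alpha>\<in>B. a \<alpha> x * partial \<alpha> (\<lambda>y. f (lower3 y)) (axis i x))"
    using assms(1) unfolding jet_local_def by blast
  let ?r = "\<lambda>k. root_val (tau k) $ i"
  define V where "V = (\<Inter>k<n. (\<lambda>x. x / ?r k) -` U)"
  define p where "p k \<alpha> = m k * (inverse (char_GL \<xi> l (diag_mat (tau k))) *
    of_real ((tau k$2 / tau k$1) ^ fst (weight \<alpha>) * (tau k$3 / tau k$2) ^ snd (weight \<alpha>)))" for k \<alpha>
  define b where "b \<alpha> x = (\<Sum>k<n. p k \<alpha> * a \<alpha> (x / ?r k))" for \<alpha> x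
  have V: "open V" "0 \<in> V"
    using U by (auto simp: V_def divide_inverse intro!: open_INT open_vimage continuous_intros)
  have "smooth_on V (b \<alpha>)" if "\<alpha> \<in> B" for \<alpha>
  proof -
    have a: "smooth_open U (a \<alpha>)" using U that by (simp add: smooth_on_open_iff)
    have "smooth_open V (\<lambda>x. a \<alpha> (x / ?r k))" if "k < n" for k
      by (rule smooth_open_compose[OF V(1) _ a])
        (use that in \<open>auto simp: V_def simp del: of_real_divide
          intro!: smooth_open_of_real_bounded_linear bounded_linear_divide V(1)[unfolded V_def]\<close>)
    then have "smooth_open V (b \<alpha>)"
      unfolding b_def by (intro smooth_open_sum smooth_open_mult smooth_open_const V) auto
    then show ?thesis using V by (simp add: smooth_on_open_iff)
  qed
  moreover have "jet {\<alpha>\<in>S. weight \<alpha> = w} c (\<lambda>g. f (emb i (lower2 x) ** g)) =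
        (\<Sum>\<alpha>\<in>B. b \<alpha> x * partial \<alpha> (\<lambda>y. f (lower3 y)) (axis i x))"
    if f: "f \<in> I_GL \<xi> l" and x: "x \<in> V" for f x
  proof -
    let ?f = "\<lambda>k g. f (diag_mat (tau k) ** g)" and ?z = "\<lambda>k. x / ?r k"
    have z: "?z k \<in> U" if "k < n" for k using x that by (auto simp: V_def)
    have ax: "(\<chi> j. root_val (tau k) $ j * axis i (?z k) $ j) = axis i x" for k
      using root_val_tau_nonzero by (simp add: vec_eq_iff axis_def)
    have "jet {\<alpha>\<in>S. weight \<alpha> = w} c (\<lambda>g. f (emb i (lower2 x) ** g))
        = (\<Sum>k<n. m k * jet S c (\<lambda>g. ?f k (emb i (lower2 (?z k)) ** g)))"
      using proj[OF I_GL_translate[OF f]] emb_lower2_diag[OF tau_nonzero]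
      by (simp add: emb_GL lower2_GL matrix_mul_assoc)
    also have "\<dots> = (\<Sum>k<n. \<Sum>\<alpha>\<in>B. m k * (a \<alpha> (?z k) * partial \<alpha> (\<lambda>y. ?f k (lower3 y)) (axis i (?z k))))"
      using loc[OF I_GL_translate[OF f tau_GL] z] by (intro sum.cong refl) (simp add: sum_distrib_left)
    also have "\<dots> = (\<Sum>k<n. \<Sum>\<alpha>\<in>B. p k \<alpha> * a \<alpha> (?z k) * partial \<alpha> (\<lambda>y. f (lower3 y)) (axis i x))"
      unfolding partial_diag[OF f tau_nonzero prod.collapse[symmetric]] ax p_def
      by (simp only: mult_ac)
    also have "\<dots> = (\<Sum>\<alpha>\<in>B. b \<alpha> x * partial \<alpha> (\<lambda>y. f (lower3 y)) (axis i x))"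
      unfolding b_def by (subst sum.swap) (simp add: sum_distrib_right)
    finally show ?thesis .
  qed
  ultimately show ?thesis
    unfolding jet_local_def using V U(3)
    by (intro exI[of _ V] exI[of _ B] exI[of _ b] conjI ballI) simp_all
qed

section \<open>From a homogeneous jet to an operator\<close>

definition jet_op :: "3 \<Rightarrow> (nat^3) set \<Rightarrow> (nat^3 \<Rightarrow> complex) \<Rightarrow> (real^3^3 \<Rightarrow> complex) \<Rightarrow> real^2^2 \<Rightarrow> complex" where
  "jet_op i S c f g = (if g \<in> GL then jet S c (\<lambda>h. f (emb i g ** h)) else 0)"

lemma smooth_open_emb_nth:
  fixes \<phi> :: "'a::real_normed_vector \<Rightarrow> real^2^2"
  assumes "open U" "\<And>j k. smooth_open U (\<lambda>x. complex_of_real (\<phi> x $ j $ k))"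
  shows "smooth_open U (\<lambda>x. complex_of_real (emb i (\<phi> x) $ j $ k))"
  using exhaust_3[of i] exhaust_3[of j] exhaust_3[of k] assms smooth_open_const[OF assms(1)]
  by (elim disjE) (simp_all add: emb_def)

text \<open>The derivatives in \<open>y\<close> are directional derivatives of the smooth function
  \<open>(g, y) \<mapsto> f (emb i g ** lower3 y)\<close> of both variables, taken in the directions \<open>(0, v)\<close>; they stay
  smooth when restricted to \<open>y = 0\<close>.\<close>

lemma smooth_jet_op:
  assumes f: "f \<in> I_GL \<xi> l"
  shows "smooth_on GL (jet_op i S c f)"
proof -
  have "smooth_open GL (\<lambda>g. partial \<alpha> (\<lambda>y. f (emb i g ** lower3 y)) 0)" for \<alpha>
  proof -
    let ?G = "\<lambda>z::(real^2^2) \<times> (real^3). f (emb i (fst z) ** lower3 (snd z))"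
    let ?V = "(GL :: (real^2^2) set) \<times> (UNIV :: (real^3) set)"
    let ?vs = "replicate (\<alpha>$1) (axis 1 1) @ replicate (\<alpha>$2) (axis 2 1) @ replicate (\<alpha>$3) (axis 3 1) :: (real^3) list"
    let ?L = "\<lambda>y. (0 :: real^2^2, y :: real^3)"
    have V: "open ?V" by (intro open_Times open_GL2 open_UNIV)
    have G: "smooth_open ?V ?G"
      by (intro smooth_open_compose_matrix[OF V _ I_GL_D(1)[OF f]] smooth_open_matrix_mult V
          smooth_open_emb_nth smooth_open_lower3_nth smooth_open_of_real_bounded_linear
          bounded_linear_compose[OF bounded_linear_vec_nth]
          bounded_linear_fst bounded_linear_snd bounded_linear_vec_nth)
        (auto intro!: GL_mult simp: emb_GL lower3_GL)
    have eq: "partial \<alpha> (\<lambda>y. f (emb i g ** lower3 y)) 0 = iter_deriv (map ?L ?vs) ?G (g, 0)" if "g \<in> GL" for g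
      using iter_deriv_affine[OF G, of ?L UNIV "(g, 0)" 0 ?vs] that
      by (simp add: partial_def bounded_linear_Pair bounded_linear_zero bounded_linear_ident)
    have "smooth_open GL (\<lambda>g. iter_deriv (map ?L ?vs) ?G (g, 0))"
      by (rule smooth_open_compose[OF open_GL2 _ smooth_open_iter_deriv[OF G]])
        (auto intro!: smooth_open_of_real_bounded_linear open_GL2 bounded_linear_Pair bounded_linear_zero bounded_linear_ident
          bounded_linear_compose[OF bounded_linear_inner_left])
    then show ?thesis
      by (rule smooth_open_cong[OF open_GL2]) (simp only: eq)
  qed
  then have "smooth_open GL (\<lambda>g. \<Sum>\<alpha>\<in>S. c \<alpha> * partial \<alpha> (\<lambda>y. f (emb i g ** lower3 y)) 0)"
    by (intro smooth_open_sum smooth_open_mult smooth_open_const open_GL2)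
  then have "smooth_open GL (jet_op i S c f)"
    by (rule smooth_open_cong[OF open_GL2]) (simp add: jet_op_def jet_def)
  then show ?thesis using open_GL2 smooth_open_imp_smooth_on by blast
qed

text \<open>The characters of \<open>\<real>\<^sup>\<times>\<close>. They are closed under multiplication by integral powers, where the parity of
  the exponent shifts the sign parameter.\<close>

definition char1 :: "bit \<Rightarrow> complex \<Rightarrow> real \<Rightarrow> complex" where
  "char1 e z x = sign_pow (sgn x) e * of_real \<bar>x\<bar> powr z"

lemma char1_times_power: "\<exists>e' z'. \<forall>x. x \<noteq> 0 \<longrightarrow> char1 e' z' x = char1 e z x * of_real (x ^ a)"
proof (induction a)
  case (Suc a)
  then obtain e' z' where *: "\<And>x. x \<noteq> 0 \<Longrightarrow> char1 e' z' x = char1 e z x * of_real (x ^ a)" by blast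
  have "char1 (e' + 1) (z' + 1) x = char1 e' z' x * of_real x" if "x \<noteq> 0" for x
    using that by (cases "e' = 0"; cases "x > 0") (auto simp: char1_def sign_pow_def powr_add sgn_if)
  then show ?case using * by (intro exI[of _ "e' + 1"] exI[of _ "z' + 1"]) (simp add: mult_ac)
qed auto

lemma char1_divide_power: "\<exists>e' z'. \<forall>x. x \<noteq> 0 \<longrightarrow> char1 e' z' x = char1 e z x / of_real (x ^ a)"
proof (induction a)
  case (Suc a)
  then obtain e' z' where *: "\<And>x. x \<noteq> 0 \<Longrightarrow> char1 e' z' x = char1 e z x / of_real (x ^ a)" by blast
  have "char1 (e' + 1) (z' - 1) x = char1 e' z' x / of_real x" if "x \<noteq> 0" for x
    using that by (cases "e' = 0"; cases "x > 0") (auto simp: char1_def sign_pow_def powr_diff sgn_if field_simps)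
  then show ?case using * by (intro exI[of _ "e' + 1"] exI[of _ "z' - 1"]) (simp add: field_simps)
qed auto

lemma char1_times_divide_power:
  "\<exists>e' z'. \<forall>x. x \<noteq> 0 \<longrightarrow> char1 e' z' x = char1 e z x * of_real (x ^ a) / of_real (x ^ b)"
proof -
  obtain e' z' where "\<And>x. x \<noteq> 0 \<Longrightarrow> char1 e' z' x = char1 e z x * of_real (x ^ a)"
    using char1_times_power by blast
  moreover obtain e'' z'' where "\<And>x. x \<noteq> 0 \<Longrightarrow> char1 e'' z'' x = char1 e' z' x / of_real (x ^ b)"
    using char1_divide_power by blast
  ultimately have "\<forall>x. x \<noteq> 0 \<longrightarrow> char1 e'' z'' x = char1 e z x * of_real (x ^ a) / of_real (x ^ b)"
    by simp
  then show ?thesis by blast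
qed

lemma char_GL_char1:
  "char_GL \<xi> l p = (\<Prod>j\<in>UNIV. char1 (\<xi>$j) (l$j) (p$j$j))"
  by (simp add: char_GL_def char1_def prod.distrib)

definition emb_diag :: "3 \<Rightarrow> real \<Rightarrow> real \<Rightarrow> real^3" where
  "emb_diag i x y = vector (if i = 1 then [x, y, 1] else if i = 2 then [1, x, y] else [x, 1, y])"

lemma char1_one: "char1 e z 1 = 1"
  by (simp add: char1_def sign_pow_one)

lemma char_GL_3:
  fixes p :: "real^3^3"
  shows "char_GL \<xi> l p =
    char1 (\<xi>$1) (l$1) (p$1$1) * char1 (\<xi>$2) (l$2) (p$2$2) * char1 (\<xi>$3) (l$3) (p$3$3)"
  unfolding char_GL_char1 UNIV_3 by (simp add: mult.assoc)

lemma char_GL_diag3: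
  fixes t :: "real^3"
  shows "char_GL \<xi> l (diag_mat t) =
    char1 (\<xi>$1) (l$1) (t$1) * char1 (\<xi>$2) (l$2) (t$2) * char1 (\<xi>$3) (l$3) (t$3)"
  by (simp add: char_GL_3)

lemma emb_diag_simps:
  "emb_diag 1 x y = vector [x, y, 1]" "emb_diag 2 x y = vector [1, x, y]"
  "emb_diag 3 x y = vector [x, 1, y]"
  by (simp_all add: emb_diag_def)

lemma torus_weight_split:
  fixes x y :: real and X Y :: complex
  assumes "x \<noteq> 0" "y \<noteq> 0"
  shows "X * Y / of_real ((y / x) ^ a * (1 / y) ^ b) =
      (X * of_real (x ^ a) / of_real (x ^ 0)) * (Y * of_real (y ^ b) / of_real (y ^ a))" (is ?A)
    and "X * Y / of_real ((x / 1) ^ a * (y / x) ^ b) =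
      (X * of_real (x ^ b) / of_real (x ^ a)) * (Y * of_real (y ^ 0) / of_real (y ^ b))" (is ?B)
    and "X * Y / of_real ((1 / x) ^ a * (y / 1) ^ b) =
      (X * of_real (x ^ a) / of_real (x ^ 0)) * (Y * of_real (y ^ 0) / of_real (y ^ b))" (is ?C)
proof -
  show ?A using assms by (simp add: power_divide divide_simps)
  show ?B using assms by (simp add: power_divide divide_simps)
  show ?C using assms by (simp add: power_divide divide_simps)
qed

text \<open>The parameters \<open>\<eta>, \<nu>\<close> are \<open>\<xi>, l\<close> at the two indices used by \<open>emb i\<close>, shifted by integers that
  depend on the weight: a homogeneous jet transforms under the diagonal matrices of \<open>GL(2)\<close> by
  the right-hand side.\<close>

lemma torus_character:
  "\<exists>\<eta> \<nu>. \<forall>p::real^2^2. p$1$1 \<noteq> 0 \<longrightarrow> p$2$2 \<noteq> 0 \<longrightarrow> (let t = emb_diag i (p$1$1) (p$2$2) in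
     inverse (char_GL \<eta> \<nu> p) =
       inverse (char_GL \<xi> l (diag_mat t)) * of_real ((t$2 / t$1) ^ a * (t$3 / t$2) ^ b))"
proof -
  have *: ?thesis
    if h: "\<And>x y. x \<noteq> 0 \<Longrightarrow> y \<noteq> 0 \<Longrightarrow>
       char_GL \<xi> l (diag_mat (emb_diag i x y)) / of_real ((emb_diag i x y$2 / emb_diag i x y$1) ^ a * (emb_diag i x y$3 / emb_diag i x y$2) ^ b)
       = (char1 e z x * of_real (x ^ a1) / of_real (x ^ b1)) * (char1 e' z' y * of_real (y ^ a2) / of_real (y ^ b2))"
    for e e' z z' a1 b1 a2 b2
  proof -
    obtain e1 z1 where 1: "\<And>x. x \<noteq> 0 \<Longrightarrow> char1 e1 z1 x = char1 e z x * of_real (x ^ a1) / of_real (x ^ b1)"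
      using char1_times_divide_power by blast
    obtain e2 z2 where 2: "\<And>x. x \<noteq> 0 \<Longrightarrow> char1 e2 z2 x = char1 e' z' x * of_real (x ^ a2) / of_real (x ^ b2)"
      using char1_times_divide_power by blast
    have "char_GL (vector [e1, e2]) (vector [z1, z2]) p = char1 e1 z1 (p$1$1) * char1 e2 z2 (p$2$2)" for p :: "real^2^2"
      by (simp add: char_GL_char1 UNIV_2)
    then have "char_GL (vector [e1, e2]) (vector [z1, z2]) p =
      (let t = emb_diag i (p$1$1) (p$2$2) in
       char_GL \<xi> l (diag_mat t) / of_real ((t$2 / t$1) ^ a * (t$3 / t$2) ^ b))"
      if "p$1$1 \<noteq> 0" "p$2$2 \<noteq> 0" for p :: "real^2^2"
      using that 1 2 h by (simp add: Let_def)
    then show ?thesis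
      by (intro exI[of _ "vector [e1, e2]"] exI[of _ "vector [z1, z2]"]) (simp add: Let_def field_simps)
  qed
  consider "i = 1" | "i = 2" | "i = 3" using exhaust_3 by blast
  then show ?thesis
  proof cases
    case 1
    show ?thesis
      by (rule *[of "\<xi>$1" "l$1" a 0 "\<xi>$2" "l$2" b a])
        (unfold 1 char_GL_diag3 emb_diag_simps vector_3 char1_one mult_1_left mult_1_right, erule (1) torus_weight_split(1))
  next
    case 2
    show ?thesis
      by (rule *[of "\<xi>$2" "l$2" b a "\<xi>$3" "l$3" 0 b])
        (unfold 2 char_GL_diag3 emb_diag_simps vector_3 char1_one mult_1_left mult_1_right, erule (1) torus_weight_split(2))
  next
    case 3
    show ?thesis
      by (rule *[of "\<xi>$1" "l$1" a 0 "\<xi>$3" "l$3" 0 b])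
        (unfold 3 char_GL_diag3 emb_diag_simps vector_3 char1_one mult_1_left mult_1_right, erule (1) torus_weight_split(3))
  qed
qed

lemma emb_upper2:
  assumes "p \<in> upper2" "p$1$1 \<noteq> 0"
  shows "emb i p = diag_mat (emb_diag i (p$1$1) (p$2$2)) ** emb i (upper_uni (p$1$2 / p$1$1))"
  using exhaust_3[of i] assms
  by (elim disjE; simp add: vec_eq_iff forall_3 diag_mat_mult_nth emb_def upper_uni_def emb_diag_def upper2_def)

text \<open>Intertwining holds by construction. Equivariance under \<open>p = t n\<close> with \<open>t\<close> diagonal and \<open>n\<close>
  unipotent is homogeneity for \<open>t\<close> and \<open>N_invariant\<close> for \<open>n\<close>.\<close>

lemma jet_op_intertwining:
  assumes hom: "\<And>\<alpha>. \<alpha> \<in> S \<Longrightarrow> weight \<alpha> = (a, b)"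
    and N: "N_invariant i \<xi> l S c" and loc: "jet_local i \<xi> l S c"
  shows "\<exists>\<eta> \<nu>. jet_op i S c \<in> intertwining_diff_ops i GL (I_GL \<xi> l) (J_GL \<eta> \<nu>)"
proof -
  obtain \<eta> \<nu> where char: "\<And>p::real^2^2. p$1$1 \<noteq> 0 \<Longrightarrow> p$2$2 \<noteq> 0 \<Longrightarrow> (let t = emb_diag i (p$1$1) (p$2$2) in
     inverse (char_GL \<eta> \<nu> p) =
       inverse (char_GL \<xi> l (diag_mat t)) * of_real ((t$2 / t$1) ^ a * (t$3 / t$2) ^ b))"
    using torus_character by blast
  have "jet_op i S c f \<in> J_GL \<eta> \<nu>" if f: "f \<in> I_GL \<xi> l" for f
    unfolding J_GL_def induced_def mem_Collect_eq
  proof (intro conjI allI impI ballI)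
    show "smooth_on GL (jet_op i S c f)" by (rule smooth_jet_op[OF f])
    show "jet_op i S c f g = 0" if "g \<notin> GL" for g using that by (simp add: jet_op_def)
    fix g p :: "real^2^2" assume g: "g \<in> GL" and p: "p \<in> GL \<inter> upper2"
    then have nz: "p$1$1 \<noteq> 0" "p$2$2 \<noteq> 0" by (auto simp: GL_def upper2_def det_2)
    let ?t = "emb_diag i (p$1$1) (p$2$2)" and ?n = "upper_uni (p$1$2 / p$1$1)"
    have t: "?t $ j \<noteq> 0" for j
      using exhaust_3[of j] exhaust_3[of i] nz by (auto simp: emb_diag_def)
    let ?f1 = "\<lambda>h. f (emb i g ** h)"
    have f1: "?f1 \<in> I_GL \<xi> l" using f g by (simp add: I_GL_translate emb_GL)
    let ?f2 = "\<lambda>h. ?f1 (diag_mat ?t ** h)"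
    have f2: "?f2 \<in> I_GL \<xi> l" by (rule I_GL_translate[OF f1 diag_mat_GL[OF t]])
    have "jet_op i S c f (g ** p) = jet S c (\<lambda>h. ?f2 (emb i ?n ** h))"
      using g p nz by (simp add: jet_op_def GL_mult emb_mult emb_upper2[of p] matrix_mul_assoc)
    also have "\<dots> = jet S c ?f2"
      by (rule N[unfolded N_invariant_def, rule_format, OF f2])
    also have "\<dots> = inverse (char_GL \<eta> \<nu> p) * jet S c ?f1"
      using jet_diag_homogeneous[OF f1 t hom] char[OF nz] by (simp add: Let_def)
    finally show "jet_op i S c f (g ** p) = inverse (char_GL \<eta> \<nu> p) * jet_op i S c f g"
      using g by (simp add: jet_op_def)
  qed
  moreover have "diff_op i GL (I_GL \<xi> l) (jet_op i S c)"
    unfolding diff_op_def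
  proof
    fix g :: "real^2^2" assume g: "g \<in> GL"
    obtain U B a where U: "open U" "0 \<in> U" "finite B" "\<forall>\<alpha>\<in>B. smooth_on U (a \<alpha>)"
      and U': "\<And>f x. f \<in> I_GL \<xi> l \<Longrightarrow> x \<in> U \<Longrightarrow> jet S c (\<lambda>g. f (emb i (lower2 x) ** g)) =
        (\<Sum>\<alpha>\<in>B. a \<alpha> x * partial \<alpha> (\<lambda>y. f (lower3 y)) (axis i x))"
      using loc unfolding jet_local_def by blast
    have "jet_op i S c f (g ** lower2 x) =
        (\<Sum>\<alpha>\<in>B. a \<alpha> x * partial \<alpha> (\<lambda>y. f (emb i g ** lower3 y)) (axis i x))"
      if "f \<in> I_GL \<xi> l" "x \<in> U" for f x
      using U'[OF I_GL_translate[OF that(1)] that(2), of "emb i g"] g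
      by (simp add: jet_op_def GL_mult lower2_GL emb_GL emb_mult matrix_mul_assoc)
    with U show "\<exists>U B a. open U \<and> 0 \<in> U \<and> finite B \<and> (\<forall>\<alpha>\<in>B. smooth_on U (a \<alpha>)) \<and>
        (\<forall>f\<in>I_GL \<xi> l. \<forall>x\<in>U. jet_op i S c f (g ** lower2 x) =
           (\<Sum>\<alpha>\<in>B. a \<alpha> x * partial \<alpha> (\<lambda>y. f (emb i g ** lower3 y)) (axis i x)))"
      by blast
  qed
  moreover have "jet_op i S c (left_translate (emb i h) f) = left_translate h (jet_op i S c f)"
    if h: "h \<in> GL" for h f
  proof
    fix g
    have "matrix_inv h ** g \<in> GL \<longleftrightarrow> g \<in> GL"
    proof -
      have "det h * det (matrix_inv h) = 1"
        using matrix_inv_GL[OF h] by (metis det_I det_mul)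
      then show ?thesis by (auto simp: GL_def det_mul)
    qed
    then show "jet_op i S c (left_translate (emb i h) f) g = left_translate h (jet_op i S c f) g"
      using h by (simp add: jet_op_def left_translate_def matrix_inv_emb emb_mult matrix_mul_assoc)
  qed
  ultimately show ?thesis unfolding intertwining_diff_ops_def by blast
qed

section \<open>Evaluation in coordinates\<close>

lemma emb_lower2_lower3:
  "emb i (lower2 x) ** lower3 y =
    lower3 (y + axis i x + (x * (if i = 1 then - y$2 else if i = 2 then y$1 else 0) / 2) *\<^sub>R axis 3 1)"
  using exhaust_3[of i]
  by (elim disjE; simp add: vec_eq_iff forall_3 emb_def lower2_def lower3_def matrix_matrix_mult_def sum_3 axis_def algebra_simps add_divide_distrib)

text \<open>The chart at \<open>lower2 x\<close> is a translation of the chart \<open>lower3\<close> by a continuous map taking 0 to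
  \<open>axis i x\<close>, so germs at \<open>axis i x\<close> in the latter determine germs at 0 in the former.\<close>

lemma germ_shift:
  assumes "\<forall>\<^sub>F y in nhds (axis i x). f (lower3 y) = f' (lower3 y)"
  shows "\<forall>\<^sub>F y in nhds 0. f (emb i (lower2 x) ** lower3 y) = f' (emb i (lower2 x) ** lower3 y)"
proof -
  let ?\<phi> = "\<lambda>y::real^3. y + axis i x + (x * (if i = 1 then - y$2 else if i = 2 then y$1 else 0) / 2) *\<^sub>R axis 3 1"
  have "isCont ?\<phi> 0"
    by (cases "i = 1"; cases "i = 2"; simp; intro continuous_intros)
  then have "filterlim ?\<phi> (nhds (?\<phi> 0)) (nhds 0)"
    unfolding isCont_def by (rule tendsto_at_iff_tendsto_nhds[of ?\<phi> 0, THEN iffD1])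
  moreover have "?\<phi> 0 = axis i x" by simp
  ultimately have "filterlim ?\<phi> (nhds (axis i x)) (nhds 0)" by (simp only:)
  from filterlim_iff[THEN iffD1, rule_format, OF this assms]
  show ?thesis unfolding emb_lower2_lower3 .
qed

lemma partial_germ:
  assumes "\<forall>\<^sub>F y in nhds a. F y = G y"
  shows "partial \<alpha> F a = partial \<alpha> G a"
proof -
  obtain U where "open U" "a \<in> U" "\<And>y. y \<in> U \<Longrightarrow> F y = G y"
    using assms unfolding eventually_nhds by blast
  then show ?thesis unfolding partial_def by (intro iter_deriv_cong)
qed

lemma lower2_0: "lower2 0 = mat 1"
  by (simp add: vec_eq_iff forall_2 lower2_def mat_def)

lemma axis_0: "axis i 0 = 0"
  by (simp add: vec_eq_iff axis_def)

text \<open>The description of \<open>D\<close> in the chart at \<open>lower2 x\<close> shows that the value does not depend on the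
  choice of the function that extends the germ of \<open>F\<close>.\<close>

lemma coord_op_eq:
  assumes D: "diff_op i G' V D" and x: "lower2 x \<in> G'" and F: "smooth_on UNIV F"
    and f: "f \<in> V" "\<forall>\<^sub>F y in nhds (axis i x). f (lower3 y) = F y"
  shows "coord_op i V D F x = D f (lower2 x)"
proof -
  have "c = D f (lower2 x)"
    if c: "\<exists>f\<in>V. (\<forall>\<^sub>F y in nhds (axis i x). f (lower3 y) = F y) \<and> c = D f (lower2 x)" for c
  proof -
    obtain f' where f': "f' \<in> V" "\<forall>\<^sub>F y in nhds (axis i x). f' (lower3 y) = F y" "c = D f' (lower2 x)"
      using c by blast
    have "\<forall>\<^sub>F y in nhds (axis i x). f' (lower3 y) = f (lower3 y)"
      using f'(2) f(2) by eventually_elim simp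
    note germ = partial_germ[OF germ_shift[OF this]]
    obtain U S a where "0 \<in> U" and e: "\<And>f z. f \<in> V \<Longrightarrow> z \<in> U \<Longrightarrow> D f (lower2 x ** lower2 z) =
        (\<Sum>\<alpha>\<in>S. a \<alpha> z * partial \<alpha> (\<lambda>y. f (emb i (lower2 x) ** lower3 y)) (axis i z))"
      using D[unfolded diff_op_def, rule_format, OF x] by blast
    show ?thesis
      using e[OF f(1) \<open>0 \<in> U\<close>] e[OF f'(1) \<open>0 \<in> U\<close>] germ f'(3) by (simp add: lower2_0 axis_0)
  qed
  then show ?thesis
    unfolding coord_op_def using F f by (auto intro!: the_equality)
qed

section \<open>Restriction to the special linear group\<close>

definition restr_SL :: "(real^3^3 \<Rightarrow> complex) \<Rightarrow> real^3^3 \<Rightarrow> complex" where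
  "restr_SL f g = (if g \<in> SL then f g else 0)"

text \<open>On \<open>SL(3)\<close> the characters agree: \<open>char_SL3\<close> involves only the first and the last diagonal entry,
  the last one with exponent \<open>- u\<^sub>2\<close>.\<close>

lemma restr_SL_in:
  assumes f: "f \<in> I_GL (vector [\<delta>$1, 0, \<delta>$2]) (vector [u$1, 0, - u$2])"
  shows "restr_SL f \<in> I_SL \<delta> u"
  unfolding I_SL_def induced_def mem_Collect_eq
proof (intro conjI allI impI ballI)
  show "smooth_on SL (restr_SL f)"
    unfolding smooth_on_def
  proof (intro ballI exI conjI)
    show "open (GL::(real^3^3) set)" by (rule open_GL3)
    show "smooth_open GL f" using I_GL_D(1)[OF f] .
  qed (use SL_subset_GL in \<open>auto simp: restr_SL_def\<close>)
  show "restr_SL f g = 0" if "g \<notin> SL" for g using that by (simp add: restr_SL_def)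
  fix g p :: "real^3^3" assume g: "g \<in> SL" and p: "p \<in> SL \<inter> upper3"
  then have "det p = 1" "p$2$1 = 0" "p$3$1 = 0" "p$3$2 = 0" by (auto simp: SL_def upper3_def)
  then have nz: "p$1$1 \<noteq> 0" "p$2$2 \<noteq> 0" "p$3$3 \<noteq> 0" by (auto simp: det_3)
  have powr: "complex_of_real \<bar>x\<bar> powr z = exp (z * complex_of_real (ln \<bar>x\<bar>))" if "x \<noteq> 0" for x z
    using that by (simp add: powr_def Ln_of_real)
  have "char_GL (vector [\<delta>$1, 0, \<delta>$2]) (vector [u$1, 0, - u$2]) p = char_SL3 \<delta> u p"
    unfolding char_GL_3 vector_3 char1_def char_SL3_def exp_add
    using nz by (simp add: powr sign_pow_def[of _ 0])
  then show "restr_SL f (g ** p) = inverse (char_SL3 \<delta> u p) * restr_SL f g"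
    using I_GL_D(2)[OF f, of g p] g p SL_subset_GL SL_mult[of g p] by (auto simp: restr_SL_def)
qed

text \<open>The jet is the expansion of \<open>D f 1\<close>. Its unipotent invariance is the equivariance of \<open>D f\<close> on the
  right, where \<open>char_SL2\<close> is trivial, and its locality is the expansion of \<open>D f\<close> near 1.\<close>

lemma SL_operator_as_jet:
  fixes \<delta> :: "bit^2" and u :: "complex^2"
  defines "\<xi> \<equiv> vector [\<delta>$1, 0, \<delta>$2]" and "l \<equiv> vector [u$1, 0, - u$2]"
  assumes D: "D \<in> intertwining_diff_ops i SL (I_SL \<delta> u) (J_SL \<sigma> v)"
  shows "\<exists>S c. finite S \<and> N_invariant i \<xi> l S c \<and> jet_local i \<xi> l S c \<and>
    (\<forall>f\<in>I_GL \<xi> l. \<forall>h\<in>SL. D (restr_SL f) h = jet S c (\<lambda>g. f (emb i h ** g)))"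
proof -
  have I: "restr_SL f \<in> I_SL \<delta> u" if "f \<in> I_GL \<xi> l" for f
    using restr_SL_in that unfolding \<xi>_def l_def by blast
  have one: "mat 1 \<in> (SL :: (real^2^2) set)" by (simp add: SL_def)
  have diff: "diff_op i SL (I_SL \<delta> u) D"
    and inter: "\<And>h f. h \<in> SL \<Longrightarrow> f \<in> I_SL \<delta> u \<Longrightarrow> D (left_translate (emb i h) f) = left_translate h (D f)"
    and J: "\<And>f. f \<in> I_SL \<delta> u \<Longrightarrow> D f \<in> J_SL \<sigma> v"
    using D by (auto simp: intertwining_diff_ops_def)
  obtain U S a where U: "open U" "0 \<in> U" "finite S" "\<forall>\<alpha>\<in>S. smooth_on U (a \<alpha>)"
    and a: "\<And>f x. f \<in> I_SL \<delta> u \<Longrightarrow> x \<in> U \<Longrightarrow> D f (mat 1 ** lower2 x) =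
           (\<Sum>\<alpha>\<in>S. a \<alpha> x * partial \<alpha> (\<lambda>y. f (emb i (mat 1) ** lower3 y)) (axis i x))"
    using diff[unfolded diff_op_def, rule_format, OF one] by blast
  define c where "c \<alpha> = a \<alpha> 0" for \<alpha>
  have expand: "D (restr_SL f) (lower2 x) = (\<Sum>\<alpha>\<in>S. a \<alpha> x * partial \<alpha> (\<lambda>y. f (lower3 y)) (axis i x))"
    if "f \<in> I_GL \<xi> l" "x \<in> U" for f x
    using a[OF I[OF that(1)] that(2)] by (simp add: emb_one restr_SL_def lower3_SL)
  have at_one: "D (restr_SL f) (mat 1) = jet S c f" if "f \<in> I_GL \<xi> l" for f
    using expand[OF that U(2)] by (simp add: jet_def c_def lower2_0 axis_0)
  have main: "D (restr_SL f) h = jet S c (\<lambda>g. f (emb i h ** g))" if f: "f \<in> I_GL \<xi> l" and h: "h \<in> SL" for f h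
  proof -
    have hG: "h \<in> GL" using h SL_subset_GL by blast
    have inv: "h ** matrix_inv h = mat 1" "matrix_inv h ** h = mat 1" using matrix_inv_GL[OF hG] .
    have "det h * det (matrix_inv h) = 1" using arg_cong[OF inv(1), of det] by (simp add: det_mul)
    then have h': "matrix_inv h \<in> SL" using h by (simp add: SL_def)
    have ii: "matrix_inv (matrix_inv h) = h" by (rule matrix_inv_eqI) (rule inv)
    have "D (restr_SL f) h = left_translate (matrix_inv h) (D (restr_SL f)) (mat 1)"
      by (simp add: left_translate_def ii)
    also have "\<dots> = D (left_translate (emb i (matrix_inv h)) (restr_SL f)) (mat 1)"
      using inter[OF h' I[OF f]] by simp
    also have "left_translate (emb i (matrix_inv h)) (restr_SL f) = restr_SL (\<lambda>g. f (emb i h ** g))"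
    proof
      fix g
      have "matrix_inv (emb i (matrix_inv h)) = emb i h"
        using h' SL_subset_GL matrix_inv_emb[of "matrix_inv h" i] ii by auto
      moreover have "emb i h ** g \<in> SL \<longleftrightarrow> g \<in> SL"
        using h by (simp add: SL_def det_mul det_emb)
      ultimately show "left_translate (emb i (matrix_inv h)) (restr_SL f) g = restr_SL (\<lambda>g. f (emb i h ** g)) g"
        by (simp add: left_translate_def restr_SL_def)
    qed
    also have "D \<dots> (mat 1) = jet S c (\<lambda>g. f (emb i h ** g))"
      by (rule at_one[OF I_GL_translate[OF f]]) (simp add: emb_GL hG)
    finally show ?thesis .
  qed
  have "N_invariant i \<xi> l S c"
    unfolding N_invariant_def
  proof (intro ballI allI)
    fix f s assume f: "f \<in> I_GL \<xi> l"
    have "upper_uni s \<in> SL \<inter> upper2" "char_SL2 \<sigma> v (upper_uni s) = 1"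
      by (simp_all add: upper_uni_SL) (simp_all add: upper2_def upper_uni_def char_SL2_def sign_pow_one)
    moreover have "\<And>p. p \<in> SL \<inter> upper2 \<Longrightarrow>
        D (restr_SL f) (mat 1 ** p) = inverse (char_SL2 \<sigma> v p) * D (restr_SL f) (mat 1)"
      using J[OF I[OF f]] one unfolding J_SL_def induced_def by blast
    ultimately have "D (restr_SL f) (mat 1 ** upper_uni s) = D (restr_SL f) (mat 1)"
      by (metis inverse_1 mult_1)
    then show "jet S c (\<lambda>g. f (emb i (upper_uni s) ** g)) = jet S c f"
      using main[OF f upper_uni_SL[of s]] at_one[OF f] by simp
  qed
  moreover have "jet_local i \<xi> l S c"
    unfolding jet_local_def
  proof (intro exI conjI ballI)
    fix f x assume "f \<in> I_GL \<xi> l" "x \<in> U"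
    then show "jet S c (\<lambda>g. f (emb i (lower2 x) ** g)) =
        (\<Sum>\<alpha>\<in>S. a \<alpha> x * partial \<alpha> (\<lambda>y. f (lower3 y)) (axis i x))"
      using expand main[OF _ lower2_SL] by simp
  qed (use U in auto)
  ultimately show ?thesis using U(3) main by blast
qed

section \<open>Decomposition into operators for the general linear group\<close>

theorem theoremJ:
  fixes i :: 3 and \<delta> :: "bit^2" and \<sigma> :: bit and u :: "complex^2" and v :: complex
    and E :: "(real^3 \<Rightarrow> complex) \<Rightarrow> real \<Rightarrow> complex"
  assumes "E \<in> Diff_SL i \<delta> u \<sigma> v"
  shows "\<exists>(n::nat) (c :: nat \<Rightarrow> complex) (T :: nat \<Rightarrow> (real^3 \<Rightarrow> complex) \<Rightarrow> real \<Rightarrow> complex).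
           (\<forall>k<n. \<exists>\<xi> l \<eta> \<nu>. T k \<in> Diff_GL i \<xi> l \<eta> \<nu>) \<and>
           E = (\<lambda>F x. \<Sum>k<n. c k * T k F x)"
proof -
  define \<xi> :: "bit^3" where "\<xi> = vector [\<delta>$1, 0, \<delta>$2]"
  define l :: "complex^3" where "l = vector [u$1, 0, - u$2]"
  obtain D where D: "D \<in> intertwining_diff_ops i SL (I_SL \<delta> u) (J_SL \<sigma> v)"
    and E: "E = coord_op i (I_SL \<delta> u) D"
    using assms unfolding Diff_SL_def by blast
  obtain S c where S: "finite S" and N: "N_invariant i \<xi> l S c" and loc: "jet_local i \<xi> l S c"
    and jet: "\<And>f h. f \<in> I_GL \<xi> l \<Longrightarrow> h \<in> SL \<Longrightarrow> D (restr_SL f) h = jet S c (\<lambda>g. f (emb i h ** g))"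
    using SL_operator_as_jet[OF D] unfolding \<xi>_def l_def by blast
  let ?S = "\<lambda>w. {\<alpha>\<in>S. weight \<alpha> = w}"
  let ?D = "\<lambda>w. jet_op i (?S w) c"
  let ?T = "\<lambda>w. coord_op i (I_GL \<xi> l) (?D w)"
  obtain b where b: "bij_betw b {..<card (weight ` S)} (weight ` S)"
    using ex_bij_betw_nat_finite[of "weight ` S"] S by (auto simp: atLeast0LessThan)
  have inter: "\<exists>\<eta> \<nu>. ?D w \<in> intertwining_diff_ops i GL (I_GL \<xi> l) (J_GL \<eta> \<nu>)" for w
    by (rule jet_op_intertwining[where a = "fst w" and b = "snd w"])
      (auto intro: N_invariant_weight[OF N S] jet_local_weight[OF loc S])
  have "E F x = (\<Sum>k<card (weight ` S). 1 * ?T (b k) F x)" for F x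
  proof (cases "smooth_on UNIV F")
    case True
    then obtain f where f: "f \<in> I_GL \<xi> l" "\<forall>\<^sub>F y in nhds (axis i x). f (lower3 y) = F y"
      using I_GL_local_extension[of F \<xi> l "axis i x"] by (auto simp: smooth_on_open_iff)
    have "E F x = D (restr_SL f) (lower2 x)"
      unfolding E
    proof (rule coord_op_eq[OF _ lower2_SL True])
      show "diff_op i SL (I_SL \<delta> u) D" using D by (simp add: intertwining_diff_ops_def)
      show "restr_SL f \<in> I_SL \<delta> u" using restr_SL_in f(1) unfolding \<xi>_def l_def by blast
      show "\<forall>\<^sub>F y in nhds (axis i x). restr_SL f (lower3 y) = F y"
        using f(2) by (simp add: restr_SL_def lower3_SL)
    qed
    also have "\<dots> = jet S c (\<lambda>g. f (emb i (lower2 x) ** g))"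
      by (rule jet[OF f(1) lower2_SL])
    also have "\<dots> = (\<Sum>w\<in>weight ` S. ?D w f (lower2 x))"
      using sum.image_gen[OF S, of _ weight] by (simp add: jet_op_def jet_def lower2_GL)
    also have "\<dots> = (\<Sum>k<card (weight ` S). ?D (b k) f (lower2 x))"
      by (rule sum.reindex_bij_betw[OF b, symmetric])
    also have "\<dots> = (\<Sum>k<card (weight ` S). ?T (b k) F x)"
    proof (rule sum.cong[OF refl])
      fix k
      have "diff_op i GL (I_GL \<xi> l) (?D (b k))"
        using inter[of "b k"] by (auto simp: intertwining_diff_ops_def)
      from coord_op_eq[OF this lower2_GL True f] show "?D (b k) f (lower2 x) = ?T (b k) F x" by simp
    qed
    finally show ?thesis by simp
  qed (simp add: E coord_op_def)
  moreover have "\<exists>\<eta> \<nu>. ?T w \<in> Diff_GL i \<xi> l \<eta> \<nu>" for w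
    using inter[of w] unfolding Diff_GL_def by blast
  ultimately show ?thesis
    by (intro exI[of _ "card (weight ` S)"] exI[of _ "\<lambda>k. 1"] exI[of _ "\<lambda>k. ?T (b k)"]) blast
qed

end
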